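(* Let $R$ be a commutative zero-sum-free semiring, $G$ a finite abelian group, and $X$ a connected $1$-skeletal simplicial set with $X_0$ and $X_1$ finite. For every simplicial set map $\varphi:X\to NG$, the $R$-convex set $\mathrm{Face}(\varphi)$ is isomorphic to $D_R(G/\varphi)$.
   Context: A semiring $R$ is zero-sum-free if $a+b=0$ implies $a=b=0$. For a set $S$, $D_R(S)$ is the set of finitely supported functions $p:S\to R$ with $\sum_s p(s)=1$; $D_R$ is a monad on sets (pushforward $D_R(f)(p)(s')=\sum_{f(s)=s'}p(s)$, unit $s\mapsto\delta^s$, multiplication $\mu(P)(s)=\sum_p P(p)p(s)$). $R$-convex sets are algebras over this monad, and $R$-convex maps are algebra maps; $D_R(S)$ is the free $R$-convex set on $S$. For a simplicial set $Y$, $D_R(Y)$ denotes the degreewise application. The set $\mathrm{sSet}(X,D_R(Y))$ of simplicial set maps is $R$-convex with structure map $\nu(Q)_n(x)=\sum_p Q(p)\,p_n(x)$. A simplicial set is $1$-skeletal if it has no non-degenerate simplices in dimension greater than $1$, and connected if its set of path components is trivial. $NG$ is the nerve of $G$: $(NG)_n=G^n$, $d_0$ drops the first entry, $d_n$ drops the last, the other $d_i$ multiply the entries $i,i+1$, and $s_j$ inserts $1_G$. The décalage $\mathrm{Dec}^0(Y)$ has $\mathrm{Dec}^0(Y)_n=Y_{n+1}$ with $i$-th face $d_{i+1}$ and $j$-th degeneracy $s_{j+1}$ of $Y$; the omitted faces $d_0$ give a simplicial set map $d_0:\mathrm{Dec}^0(Y)\to Y$. For $\varphi:X\to Y$, $\delta^\varphi:X\to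 D_R(Y)$ sends $x$ to $\delta^{\varphi(x)}$, and $$\mathrm{Face}(\varphi)=\{p\in \mathrm{sSet}(X,D_R(\mathrm{Dec}^0 Y)) : D_R(d_0)\circ p=\delta^\varphi\},$$ an $R$-convex subset. A circle is a simplicial set $C$ specified by a sequence of pairwise distinct $1$-simplices $\sigma_1,\dots,\sigma_n$ together with indices $i_k\in\{0,1\}$, $i'_k=1-i_k$, such that $d_{i'_k}(\sigma_k)=d_{i_{k+1}}(\sigma_{k+1})$ for $1\le k\le n-1$ and $d_{i_1}(\sigma_1)=d_{i'_n}(\sigma_n)$. For a circle $C\subset X$ set $(C,\varphi|_C)=\prod_{k=1}^n g_k$, where $g_k=\varphi_{\sigma_k}$ if $i_k=1$ and $g_k=\varphi_{\sigma_k}^{-1}$ if $i_k=0$. $H_\varphi\subset G$ is the subgroup generated by the elements $(C,\varphi|_C)$ for all circles $C\subset X$, and $G/\varphi$ is the set of orbits of $G$ under the action of $H_\varphi$ by multiplication from the right. Here $D_R(G/\varphi)$ is identified with the set of distributions $p\in D_R(G)$ satisfying $p(g\cdot h)=p(g)$ for all $h\in H_\varphi$, by regarding $q:G/\varphi\to R$ as $\tilde q:G\to R$, $\tilde q(g)=q(\bar g)/|H_\varphi|$, where $\bar g$ is the image of $g$ in $G/\varphi$.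
   Formalization: Face(φ) is shown isomorphic to the H_φ-invariant distributions on G for every R; the isomorphism with the free D_R(G/φ) is stated when |H_φ| is invertible in R, as it fails otherwise (R = ℕ, H_φ nontrivial: Face(φ) is empty). *)

theory Defs
  imports "HOL-Algebra.Generated_Groups" "HOL-Algebra.Coset" "HOL-Algebra.FiniteProduct"
begin

section \<open>The distribution monad and convex sets over a semiring\<close>

text \<open>
  The sort \<open>{comm_semiring_0, comm_monoid_mult}\<close> is that of commutative semirings with \<open>0\<close> and \<open>1\<close>;
  unlike \<open>comm_semiring_1\<close> it does not impose \<open>0 \<noteq> 1\<close>.
\<close>

definition zero_sum_free :: "'r::comm_monoid_add itself \<Rightarrow> bool" where
  "zero_sum_free _ \<longleftrightarrow> (\<forall>a b :: 'r. a + b = 0 \<longrightarrow> a = 0 \<and> b = 0)"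

text \<open>
  A distribution on \<open>S\<close> is represented by its extension by zero to the whole type, so that
  equality of distributions is equality of functions.
\<close>

definition dists :: "'s set \<Rightarrow> ('s \<Rightarrow> 'r::{comm_semiring_0, comm_monoid_mult}) set" where
  "dists S = {p. finite {s. p s \<noteq> 0} \<and> {s. p s \<noteq> 0} \<subseteq> S \<and> (\<Sum>s | p s \<noteq> 0. p s) = 1}"

definition dist_push ::
    "('s \<Rightarrow> 't) \<Rightarrow> ('s \<Rightarrow> 'r::{comm_semiring_0, comm_monoid_mult}) \<Rightarrow> ('t \<Rightarrow> 'r)" where
  "dist_push f p = (\<lambda>t. \<Sum>s | p s \<noteq> 0 \<and> f s = t. p s)"

definition dist_unit :: "'s \<Rightarrow> ('s \<Rightarrow> 'r::{comm_semiring_0, comm_monoid_mult})" where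
  "dist_unit s = (\<lambda>t. if t = s then 1 else 0)"

definition dist_join ::
    "(('s \<Rightarrow> 'r) \<Rightarrow> 'r::{comm_semiring_0, comm_monoid_mult}) \<Rightarrow> ('s \<Rightarrow> 'r)" where
  "dist_join P = (\<lambda>s. \<Sum>p | P p \<noteq> 0. P p * p s)"

locale convex_set =
  fixes A :: "'a set"
    and \<nu> :: "('a \<Rightarrow> 'r::{comm_semiring_0, comm_monoid_mult}) \<Rightarrow> 'a"
  assumes closed: "Q \<in> dists A \<Longrightarrow> \<nu> Q \<in> A"
    and unit: "a \<in> A \<Longrightarrow> \<nu> (dist_unit a) = a"
    and assoc: "P \<in> dists (dists A) \<Longrightarrow> \<nu> (dist_join P) = \<nu> (dist_push \<nu> P)"

definition convex_map ::
    "'a set \<Rightarrow> (('a \<Rightarrow> 'r::{comm_semiring_0, comm_monoid_mult}) \<Rightarrow> 'a) \<Rightarrow>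
     'b set \<Rightarrow> (('b \<Rightarrow> 'r) \<Rightarrow> 'b) \<Rightarrow> ('a \<Rightarrow> 'b) \<Rightarrow> bool" where
  "convex_map A \<nu> B \<kappa> f \<longleftrightarrow>
     f \<in> A \<rightarrow> B \<and> (\<forall>Q \<in> dists A. f (\<nu> Q) = \<kappa> (dist_push f Q))"

definition convex_iso ::
    "'a set \<Rightarrow> (('a \<Rightarrow> 'r::{comm_semiring_0, comm_monoid_mult}) \<Rightarrow> 'a) \<Rightarrow>
     'b set \<Rightarrow> (('b \<Rightarrow> 'r) \<Rightarrow> 'b) \<Rightarrow> ('a \<Rightarrow> 'b) \<Rightarrow> bool" where
  "convex_iso A \<nu> B \<kappa> f \<longleftrightarrow>
     convex_set A \<nu> \<and> convex_set B \<kappa> \<and> convex_map A \<nu> B \<kappa> f \<and>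
     (\<exists>g. convex_map B \<kappa> A \<nu> g \<and> (\<forall>a \<in> A. g (f a) = a) \<and> (\<forall>b \<in> B. f (g b) = b))"

definition convex_isomorphic ::
    "'a set \<Rightarrow> (('a \<Rightarrow> 'r::{comm_semiring_0, comm_monoid_mult}) \<Rightarrow> 'a) \<Rightarrow>
     'b set \<Rightarrow> (('b \<Rightarrow> 'r) \<Rightarrow> 'b) \<Rightarrow> bool" where
  "convex_isomorphic A \<nu> B \<kappa> \<longleftrightarrow> (\<exists>f. convex_iso A \<nu> B \<kappa> f)"


section \<open>Simplicial sets\<close>

text \<open>
  \<open>face X n i\<close> is \<open>d\<^sub>i : X\<^sub>n \<rightarrow> X\<^sub>n\<^sub>-\<^sub>1\<close> (relevant for \<open>n \<ge> 1\<close>, \<open>i \<le> n\<close>) and \<open>degen X n j\<close> is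
  \<open>s\<^sub>j : X\<^sub>n \<rightarrow> X\<^sub>n\<^sub>+\<^sub>1\<close> (relevant for \<open>j \<le> n\<close>). All simplices live in one type; the sets
  \<open>simplices X n\<close> for different \<open>n\<close> need not be disjoint.
\<close>

record 'x sset =
  simplices :: "nat \<Rightarrow> 'x set"
  face :: "nat \<Rightarrow> nat \<Rightarrow> 'x \<Rightarrow> 'x"
  degen :: "nat \<Rightarrow> nat \<Rightarrow> 'x \<Rightarrow> 'x"

locale simplicial_set =
  fixes X :: "'x sset"
  assumes face_closed:
      "\<lbrakk>x \<in> simplices X (Suc n); i \<le> Suc n\<rbrakk> \<Longrightarrow> face X (Suc n) i x \<in> simplices X n"
    and degen_closed:
      "\<lbrakk>x \<in> simplices X n; j \<le> n\<rbrakk> \<Longrightarrow> degen X n j x \<in> simplices X (Suc n)"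
    and face_face:
      "\<lbrakk>x \<in> simplices X (Suc (Suc n)); i < j; j \<le> Suc (Suc n)\<rbrakk> \<Longrightarrow>
        face X (Suc n) i (face X (Suc (Suc n)) j x) =
        face X (Suc n) (j - 1) (face X (Suc (Suc n)) i x)"
    and degen_degen:
      "\<lbrakk>x \<in> simplices X n; i \<le> j; j \<le> n\<rbrakk> \<Longrightarrow>
        degen X (Suc n) i (degen X n j x) = degen X (Suc n) (Suc j) (degen X n i x)"
    and face_degen_less:
      "\<lbrakk>x \<in> simplices X (Suc n); i < j; j \<le> Suc n\<rbrakk> \<Longrightarrow>
        face X (Suc (Suc n)) i (degen X (Suc n) j x) =
        degen X n (j - 1) (face X (Suc n) i x)"
    and face_degen_same:
      "\<lbrakk>x \<in> simplices X n; j \<le> n; i = j \<or> i = Suc j\<rbrakk> \<Longrightarrow>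
        face X (Suc n) i (degen X n j x) = x"
    and face_degen_greater:
      "\<lbrakk>x \<in> simplices X (Suc n); Suc j < i; i \<le> Suc (Suc n)\<rbrakk> \<Longrightarrow>
        face X (Suc (Suc n)) i (degen X (Suc n) j x) =
        degen X n j (face X (Suc n) (i - 1) x)"

text \<open>
  Simplicial maps are taken to be \<open>undefined\<close> off the simplices of their domain, so that equality
  of simplicial maps is equality of functions.
\<close>

definition sset_maps :: "'x sset \<Rightarrow> 'y sset \<Rightarrow> (nat \<Rightarrow> 'x \<Rightarrow> 'y) set" where
  "sset_maps X Y = {f.
     (\<forall>n. f n \<in> simplices X n \<rightarrow>\<^sub>E simplices Y n) \<and>
     (\<forall>n. \<forall>x \<in> simplices X (Suc n). \<forall>i \<le> Suc n.
        f n (face X (Suc n) i x) = face Y (Suc n) i (f (Suc n) x)) \<and>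
     (\<forall>n. \<forall>x \<in> simplices X n. \<forall>j \<le> n.
        f (Suc n) (degen X n j x) = degen Y n j (f n x))}"

definition degenerate :: "'x sset \<Rightarrow> nat \<Rightarrow> 'x \<Rightarrow> bool" where
  "degenerate X n x \<longleftrightarrow>
     (\<exists>m j y. n = Suc m \<and> j \<le> m \<and> y \<in> simplices X m \<and> x = degen X m j y)"

definition one_skeletal :: "'x sset \<Rightarrow> bool" where
  "one_skeletal X \<longleftrightarrow> (\<forall>n > 1. \<forall>x \<in> simplices X n. degenerate X n x)"

definition edge_rel :: "'x sset \<Rightarrow> ('x \<times> 'x) set" where
  "edge_rel X = {(face X 1 1 \<sigma>, face X 1 0 \<sigma>) | \<sigma>. \<sigma> \<in> simplices X 1}"

definition path_components :: "'x sset \<Rightarrow> 'x set set" where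
  "path_components X = simplices X 0 // (edge_rel X \<union> (edge_rel X)\<inverse>)\<^sup>*"

text \<open>In particular, a connected simplicial set is nonempty.\<close>

definition sset_connected :: "'x sset \<Rightarrow> bool" where
  "sset_connected X \<longleftrightarrow> is_singleton (path_components X)"

definition dist_sset ::
    "'y sset \<Rightarrow> ('y \<Rightarrow> 'r::{comm_semiring_0, comm_monoid_mult}) sset" where
  "dist_sset Y = \<lparr> simplices = (\<lambda>n. dists (simplices Y n)),
                   face = (\<lambda>n i. dist_push (face Y n i)),
                   degen = (\<lambda>n j. dist_push (degen Y n j)) \<rparr>"

definition maps_join ::
    "'x sset \<Rightarrow> ((nat \<Rightarrow> 'x \<Rightarrow> ('y \<Rightarrow> 'r)) \<Rightarrow> 'r::{comm_semiring_0, comm_monoid_mult}) \<Rightarrow>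
     (nat \<Rightarrow> 'x \<Rightarrow> ('y \<Rightarrow> 'r))" where
  "maps_join X Q = (\<lambda>n. \<lambda>x \<in> simplices X n. \<lambda>y. \<Sum>p | Q p \<noteq> 0. Q p * p n x y)"

definition dec0 :: "'y sset \<Rightarrow> 'y sset" where
  "dec0 Y = \<lparr> simplices = (\<lambda>n. simplices Y (Suc n)),
              face = (\<lambda>n i. face Y (Suc n) (Suc i)),
              degen = (\<lambda>n j. degen Y (Suc n) (Suc j)) \<rparr>"

definition Face ::
    "'x sset \<Rightarrow> 'y sset \<Rightarrow> (nat \<Rightarrow> 'x \<Rightarrow> 'y) \<Rightarrow>
     (nat \<Rightarrow> 'x \<Rightarrow> ('y \<Rightarrow> 'r::{comm_semiring_0, comm_monoid_mult})) set" where
  "Face X Y \<phi> = {p \<in> sset_maps X (dist_sset (dec0 Y)).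
     \<forall>n. \<forall>x \<in> simplices X n. dist_push (face Y (Suc n) 0) (p n x) = dist_unit (\<phi> n x)}"


section \<open>The nerve of a group and circles\<close>

definition nerve_face :: "('g, 'm) monoid_scheme \<Rightarrow> nat \<Rightarrow> nat \<Rightarrow> 'g list \<Rightarrow> 'g list" where
  "nerve_face G n i gs =
     (if i = 0 then tl gs
      else if i = n then butlast gs
      else take (i - 1) gs @ [gs ! (i - 1) \<otimes>\<^bsub>G\<^esub> gs ! i] @ drop (i + 1) gs)"

definition nerve :: "('g, 'm) monoid_scheme \<Rightarrow> 'g list sset" where
  "nerve G = \<lparr> simplices = (\<lambda>n. {gs. length gs = n \<and> set gs \<subseteq> carrier G}),
               face = nerve_face G,
               degen = (\<lambda>n j gs. take j gs @ [\<one>\<^bsub>G\<^esub>] @ drop j gs) \<rparr>"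

text \<open>
  A circle in \<open>X\<close> is given by its edges \<open>\<sigma> k\<close> and starting indices \<open>\<iota> k\<close>, for \<open>k = 1, \<dots>, n\<close>:
  the edge \<open>\<sigma> k\<close> is traversed from its \<open>\<iota> k\<close>-th face to its \<open>(1 - \<iota> k)\<close>-th face.
\<close>

definition circle :: "'x sset \<Rightarrow> nat \<Rightarrow> (nat \<Rightarrow> 'x) \<Rightarrow> (nat \<Rightarrow> nat) \<Rightarrow> bool" where
  "circle X n \<sigma> \<iota> \<longleftrightarrow>
     n \<ge> 1 \<and> \<sigma> \<in> {1..n} \<rightarrow> simplices X 1 \<and> inj_on \<sigma> {1..n} \<and> \<iota> \<in> {1..n} \<rightarrow> {0, 1} \<and>
     (\<forall>k \<in> {1..<n}. face X 1 (1 - \<iota> k) (\<sigma> k) = face X 1 (\<iota> (k + 1)) (\<sigma> (k + 1))) \<and>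
     face X 1 (\<iota> 1) (\<sigma> 1) = face X 1 (1 - \<iota> n) (\<sigma> n)"

text \<open>\<open>hd (\<phi> 1 \<sigma>)\<close> is the group element \<open>\<phi>\<^sub>\<sigma>\<close>, since 1-simplices of the nerve are one-element lists.\<close>

definition circle_value ::
    "('g, 'm) monoid_scheme \<Rightarrow> (nat \<Rightarrow> 'x \<Rightarrow> 'g list) \<Rightarrow>
     nat \<Rightarrow> (nat \<Rightarrow> 'x) \<Rightarrow> (nat \<Rightarrow> nat) \<Rightarrow> 'g" where
  "circle_value G \<phi> n \<sigma> \<iota> =
     (\<Otimes>\<^bsub>G\<^esub>k \<in> {1..n}. if \<iota> k = 1 then hd (\<phi> 1 (\<sigma> k)) else inv\<^bsub>G\<^esub> (hd (\<phi> 1 (\<sigma> k))))"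

definition circle_subgroup ::
    "('g, 'm) monoid_scheme \<Rightarrow> 'x sset \<Rightarrow> (nat \<Rightarrow> 'x \<Rightarrow> 'g list) \<Rightarrow> 'g set" where
  "circle_subgroup G X \<phi> = generate G {circle_value G \<phi> n \<sigma> \<iota> | n \<sigma> \<iota>. circle X n \<sigma> \<iota>}"

text \<open>The orbit of \<open>g\<close> under right multiplication by \<open>H\<close> is the left coset \<open>g <# H\<close>.\<close>

definition orbit_set ::
    "('g, 'm) monoid_scheme \<Rightarrow> 'x sset \<Rightarrow> (nat \<Rightarrow> 'x \<Rightarrow> 'g list) \<Rightarrow> 'g set set" where
  "orbit_set G X \<phi> = (\<lambda>g. g <#\<^bsub>G\<^esub> circle_subgroup G X \<phi>) ` carrier G"

definition invariant_dists ::
    "('g, 'm) monoid_scheme \<Rightarrow> 'x sset \<Rightarrow> (nat \<Rightarrow> 'x \<Rightarrow> 'g list) \<Rightarrow>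
     ('g \<Rightarrow> 'r::{comm_semiring_0, comm_monoid_mult}) set" where
  "invariant_dists G X \<phi> = {p \<in> dists (carrier G).
     \<forall>g \<in> carrier G. \<forall>h \<in> circle_subgroup G X \<phi>. p (g \<otimes>\<^bsub>G\<^esub> h) = p g}"

text \<open>
  The function \<open>g \<mapsto> q(g H) / |H|\<close> on \<open>G\<close> attached to \<open>q : G/H \<rightarrow> R\<close>, where \<open>u\<close> plays the role of
  \<open>1 / |H|\<close>. A semiring need not contain such a \<open>u\<close>. If it does not, there are no invariant
  distributions: for an invariant \<open>p\<close>, summing \<open>p\<close> over representatives of the cosets gives an
  inverse of \<open>|H|\<close>.
\<close>

definition lift_dist ::
    "('g, 'm) monoid_scheme \<Rightarrow> 'x sset \<Rightarrow> (nat \<Rightarrow> 'x \<Rightarrow> 'g list) \<Rightarrow>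
     'r::{comm_semiring_0, comm_monoid_mult} \<Rightarrow> ('g set \<Rightarrow> 'r) \<Rightarrow> ('g \<Rightarrow> 'r)" where
  "lift_dist G X \<phi> u q =
     (\<lambda>g. if g \<in> carrier G then q (g <#\<^bsub>G\<^esub> circle_subgroup G X \<phi>) * u else 0)"

end

theory Submission
  imports Defs
begin

text \<open>
  Zero-sum-freeness forces the distribution \<open>p n x\<close> of a face map to live on the lists \<open>g # \<phi> n x\<close>,
  so it amounts to a distribution on \<open>G\<close>. The simplicial identities make that distribution depend only
  on the first vertex of \<open>x\<close>, and passing from one end of an edge \<open>\<sigma>\<close> to the other translates it by
  \<open>\<phi>\<^sub>\<sigma>\<close>. By connectedness one distribution \<open>q\<close>, at a base vertex, determines all the others, and the
  only constraint is that \<open>q\<close> be invariant under the values of closed walks, which generate the circle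
  subgroup.
\<close>


section \<open>Expectations of distributions\<close>

text \<open>Zero-sum-freeness matters because the weights of a distribution could otherwise cancel
  inside a fibre of d_0; without cancellation, a push-forward equal to a point mass confines the
  whole support to one fibre. The comparison map is evaluation at the base vertex followed by
  \<open>hd\<close>. Its inverse rests on a chosen walk from the base vertex to each vertex; two
  choices have values that differ by an element of the circle subgroup H, which an invariant q does
  not see. Circles have distinct edges and may miss the base vertex, whereas transport concerns
  arbitrary walks starting there. Commutativity of G bridges this gap: a loop can be moved past a
  connecting walk, and the value of a walk with repeated edges can be regrouped. The passage to
  G/\<phi> is kept apart since it divides by |H|: it is made for each u with u |H| = 1, while
  invariant distributions make sense over every R. Sums are handled through
  \<open>dist_expect\<close>, the integral of a test function, because supports of push-forwards and
  joins can shrink and are awkward as index sets.\<close>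

definition dist_expect ::
    "('s \<Rightarrow> 'r::{comm_semiring_0, comm_monoid_mult}) \<Rightarrow> ('s \<Rightarrow> 'r) \<Rightarrow> 'r" where
  "dist_expect p h = (\<Sum>s | p s \<noteq> 0. p s * h s)"

lemma dist_expect_superset:
  assumes "finite F" and "{s. p s \<noteq> 0} \<subseteq> F"
  shows "dist_expect p h = (\<Sum>s\<in>F. p s * h s)"
  unfolding dist_expect_def using assms by (intro sum.mono_neutral_left) auto

lemma dist_expect_cong:
  "(\<And>s. p s \<noteq> 0 \<Longrightarrow> h s = h' s) \<Longrightarrow> dist_expect p h = dist_expect p h'"
  unfolding dist_expect_def by (rule sum.cong) auto

lemma dist_expect_mult_right: "dist_expect p h * u = dist_expect p (\<lambda>s. h s * u)"
  unfolding dist_expect_def by (simp add: sum_distrib_right mult.assoc)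

lemma dist_expect_unit: "dist_expect (dist_unit a) h = h a"
  by (subst dist_expect_superset[of "{a}"]) (auto simp: dist_unit_def)

lemma dists_iff:
  "p \<in> dists S \<longleftrightarrow>
     finite {s. p s \<noteq> 0} \<and> {s. p s \<noteq> 0} \<subseteq> S \<and> dist_expect p (\<lambda>_. 1) = 1"
  by (simp add: dists_def dist_expect_def)

lemma dists_finite_support: "p \<in> dists S \<Longrightarrow> finite {s. p s \<noteq> 0}"
  and dists_support: "p \<in> dists S \<Longrightarrow> p s \<noteq> 0 \<Longrightarrow> s \<in> S"
  and dists_total: "p \<in> dists S \<Longrightarrow> dist_expect p (\<lambda>_. 1) = 1"
  by (auto simp: dists_iff)

lemma dists_mono: "S \<subseteq> T \<Longrightarrow> dists S \<subseteq> dists T"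
  by (blast intro: dists_iff[THEN iffD2] dest: dists_iff[THEN iffD1])

text \<open>The test function is the indicator of the fibre over \<open>t\<close>. In this form,
  identities between push-forwards reduce to identities between expectations.\<close>

lemma dist_push_eq_expect:
  assumes "finite {s. p s \<noteq> 0}"
  shows "dist_push f p t = dist_expect p (\<lambda>s. dist_unit (f s) t)"
  unfolding dist_push_def dist_expect_def using assms
  by (intro sum.mono_neutral_cong_left) (auto simp: dist_unit_def)

lemma dist_push_support: "{t. dist_push f p t \<noteq> 0} \<subseteq> f ` {s. p s \<noteq> 0}"
proof
  fix t assume "t \<in> {t. dist_push f p t \<noteq> 0}"
  then have "{s. p s \<noteq> 0 \<and> f s = t} \<noteq> {}"
    unfolding dist_push_def by (metis (mono_tags) mem_Collect_eq sum.empty)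
  then show "t \<in> f ` {s. p s \<noteq> 0}" by auto
qed

lemma dist_push_finite_support:
  assumes "finite {s. p s \<noteq> 0}"
  shows "finite {t. dist_push f p t \<noteq> 0}"
  by (rule finite_subset[OF dist_push_support[of f p] finite_imageI[OF assms]])

text \<open>Change of variables: the support of \<open>p\<close> is grouped by the fibres of
  \<open>f\<close>. The sum on the left is taken over the image of the support, since the support of
  the push-forward may be smaller.\<close>

lemma dist_expect_push:
  assumes fin: "finite {s. p s \<noteq> 0}"
  shows "dist_expect (dist_push f p) h = dist_expect p (\<lambda>s. h (f s))"
proof -
  let ?S = "{s. p s \<noteq> 0}"
  have "dist_expect (dist_push f p) h = (\<Sum>t\<in>f ` ?S. dist_push f p t * h t)"
    by (rule dist_expect_superset[OF finite_imageI[OF fin] dist_push_support[of f p]])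
  also have "\<dots> = (\<Sum>t\<in>f ` ?S. \<Sum>s\<in>{s \<in> ?S. f s = t}. p s * h (f s))"
    unfolding dist_push_def sum_distrib_right by (intro sum.cong) auto
  also have "\<dots> = dist_expect p (\<lambda>s. h (f s))"
    unfolding dist_expect_def
    by (rule sum.image_gen[OF fin, where h = "\<lambda>s. p s * h (f s)" and g = f, symmetric])
  finally show ?thesis .
qed

lemma dist_push_in_dists:
  assumes "p \<in> dists S" and "\<And>s. s \<in> S \<Longrightarrow> f s \<in> T"
  shows "dist_push f p \<in> dists T"
proof -
  have "{t. dist_push f p t \<noteq> 0} \<subseteq> T"
    using dist_push_support[of f p] assms by (blast dest: dists_support)
  then show ?thesis
    using assms(1)
    by (simp add: dists_iff[of _ T] dist_push_finite_support dist_expect_push dists_finite_support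
        dists_total)
qed

lemma dist_push_cong:
  "(\<And>s. p s \<noteq> 0 \<Longrightarrow> f s = g s) \<Longrightarrow> dist_push f p = dist_push g p"
  unfolding dist_push_def by (intro ext sum.cong) auto

lemma dist_push_push:
  assumes "finite {s. p s \<noteq> 0}"
  shows "dist_push g (dist_push f p) = dist_push (\<lambda>s. g (f s)) p"
proof
  fix t
  have "dist_push g (dist_push f p) t = dist_expect (dist_push f p) (\<lambda>s. dist_unit (g s) t)"
    by (rule dist_push_eq_expect[OF dist_push_finite_support[OF assms]])
  also have "\<dots> = dist_expect p (\<lambda>s. dist_unit (g (f s)) t)"
    by (rule dist_expect_push[OF assms])
  also have "\<dots> = dist_push (\<lambda>s. g (f s)) p t"
    by (rule dist_push_eq_expect[OF assms, symmetric])
  finally show "dist_push g (dist_push f p) t = dist_push (\<lambda>s. g (f s)) p t" .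
qed

lemma dist_push_ident:
  assumes "\<And>s. p s \<noteq> 0 \<Longrightarrow> f s = s"
  shows "dist_push f p = p"
proof
  fix t
  have "dist_push f p t = (\<Sum>s \<in> (if p t = 0 then {} else {t}). p s)"
    unfolding dist_push_def using assms by (intro sum.cong) auto
  then show "dist_push f p t = p t" by simp
qed

lemma dist_push_const:
  assumes "p \<in> dists S" and "\<And>s. s \<in> S \<Longrightarrow> f s = a"
  shows "dist_push f p = dist_unit a"
proof
  fix t
  have "dist_push f p t = dist_expect p (\<lambda>s. 1 * dist_unit a t)"
    using assms by (auto simp: dist_push_eq_expect[OF dists_finite_support]
      intro!: dist_expect_cong dest: dists_support)
  also have "\<dots> = dist_expect p (\<lambda>_. 1) * dist_unit a t"
    by (rule dist_expect_mult_right[symmetric])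
  finally show "dist_push f p t = dist_unit a t"
    using assms(1) by (simp add: dists_total)
qed

lemma zero_sum_free_sum:
  fixes f :: "'s \<Rightarrow> 'r::comm_monoid_add"
  assumes "zero_sum_free TYPE('r)" and "finite A" and "sum f A = 0" and "a \<in> A"
  shows "f a = 0"
  using assms sum.remove[of A a f] unfolding zero_sum_free_def by metis

text \<open>A fibre sum with a nonzero term cannot vanish when nothing cancels. Together with
  \<open>dist_push_support\<close> this makes the support of a push-forward exactly the image of the
  support.\<close>

lemma dist_push_nonzero:
  fixes p :: "'s \<Rightarrow> 'r::{comm_semiring_0, comm_monoid_mult}"
  assumes zsf: "zero_sum_free TYPE('r)" and fin: "finite {s. p s \<noteq> 0}" and s: "p s \<noteq> 0"
  shows "dist_push f p (f s) \<noteq> 0"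
proof
  have "finite {s'. p s' \<noteq> 0 \<and> f s' = f s}" using fin by (rule rev_finite_subset) auto
  moreover assume "dist_push f p (f s) = 0"
  ultimately show False
    using zero_sum_free_sum[OF zsf, of "{s'. p s' \<noteq> 0 \<and> f s' = f s}" p s] s
    by (simp add: dist_push_def)
qed

lemma dist_push_inj_apply:
  assumes "inj_on f S" and "s \<in> S" and "{s. p s \<noteq> 0} \<subseteq> S"
  shows "dist_push f p (f s) = p s"
proof -
  have "dist_push f p (f s) = (\<Sum>s \<in> (if p s = 0 then {} else {s}). p s)"
    unfolding dist_push_def using assms by (intro sum.cong) (auto dest: inj_onD)
  then show ?thesis by simp
qed

section \<open>Joins as iterated expectations\<close>

lemma dist_join_eq_expect: "dist_join P s = dist_expect P (\<lambda>p. p s)"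
  by (simp add: dist_join_def dist_expect_def)

lemma dist_join_support: "{s. dist_join P s \<noteq> 0} \<subseteq> (\<Union>p \<in> {p. P p \<noteq> 0}. {s. p s \<noteq> 0})"
proof
  fix s assume "s \<in> {s. dist_join P s \<noteq> 0}"
  then have "\<exists>p \<in> {p. P p \<noteq> 0}. P p * p s \<noteq> 0"
    unfolding dist_join_def by (metis (mono_tags, lifting) mem_Collect_eq sum.neutral)
  then show "s \<in> (\<Union>p \<in> {p. P p \<noteq> 0}. {s. p s \<noteq> 0})" by auto
qed

text \<open>An exchange of two finite sums. The union \<open>?F\<close> of all supports involved
  serves as an index set that does not depend on \<open>p\<close>.\<close>

lemma dist_expect_join:
  assumes fin: "finite {p. P p \<noteq> 0}" and fins: "\<And>p. P p \<noteq> 0 \<Longrightarrow> finite {s. p s \<noteq> 0}"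
  shows "dist_expect (dist_join P) h = dist_expect P (\<lambda>p. dist_expect p h)"
proof -
  let ?F = "\<Union>p \<in> {p. P p \<noteq> 0}. {s. p s \<noteq> 0}"
  have F: "finite ?F" using assms by auto
  have "dist_expect (dist_join P) h = (\<Sum>s\<in>?F. dist_join P s * h s)"
    by (rule dist_expect_superset[OF F dist_join_support])
  also have "\<dots> = (\<Sum>p | P p \<noteq> 0. \<Sum>s\<in>?F. P p * p s * h s)"
    unfolding dist_join_def sum_distrib_right by (rule sum.swap)
  also have "\<dots> = (\<Sum>p | P p \<noteq> 0. P p * (\<Sum>s\<in>?F. p s * h s))"
    by (simp add: sum_distrib_left mult.assoc)
  also have "\<dots> = (\<Sum>p | P p \<noteq> 0. P p * dist_expect p h)"
    by (intro sum.cong refl arg_cong2[of _ _ _ _ "(*)"] dist_expect_superset[OF F, symmetric]) auto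
  finally show ?thesis by (simp add: dist_expect_def)
qed

lemma dist_expect_join_dists:
  "P \<in> dists A \<Longrightarrow> A \<subseteq> dists S \<Longrightarrow>
    dist_expect (dist_join P) h = dist_expect P (\<lambda>p. dist_expect p h)"
  by (rule dist_expect_join) (auto dest: dists_support dists_finite_support)

lemma dist_join_in_dists:
  assumes "P \<in> dists (dists S)"
  shows "dist_join P \<in> dists S"
proof -
  have "dist_expect (dist_join P) (\<lambda>_. 1) = dist_expect P (\<lambda>p. dist_expect p (\<lambda>_. 1))"
    by (rule dist_expect_join_dists[OF assms order_refl])
  also have "\<dots> = dist_expect P (\<lambda>_. 1)"
    using assms by (intro dist_expect_cong) (auto dest: dists_support dists_total)
  finally have "dist_expect (dist_join P) (\<lambda>_. 1) = 1"
    using assms by (simp add: dists_total)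
  moreover have "finite (\<Union>p \<in> {p. P p \<noteq> 0}. {s. p s \<noteq> 0})"
    using assms by (auto dest: dists_support dists_finite_support)
  moreover have "(\<Union>p \<in> {p. P p \<noteq> 0}. {s. p s \<noteq> 0}) \<subseteq> S"
    using assms by (blast dest: dists_support)
  ultimately show ?thesis
    unfolding dists_iff using dist_join_support[of P] by (meson finite_subset order_trans)
qed

lemma dist_push_join:
  assumes "P \<in> dists (dists S)"
  shows "dist_push f (dist_join P) t = dist_expect P (\<lambda>p. dist_push f p t)"
proof -
  have "dist_push f (dist_join P) t = dist_expect P (\<lambda>p. dist_expect p (\<lambda>s. dist_unit (f s) t))"
    by (simp only: dist_push_eq_expect[OF dists_finite_support[OF dist_join_in_dists[OF assms]]]
        dist_expect_join_dists[OF assms order_refl])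
  also have "\<dots> = dist_expect P (\<lambda>p. dist_push f p t)"
    using assms
    by (intro dist_expect_cong dist_push_eq_expect[symmetric])
      (blast dest: dists_support dists_finite_support)
  finally show ?thesis .
qed


section \<open>Convex sets of distributions and convex isomorphisms\<close>

text \<open>The algebra laws are those of the monad multiplication and pass to subsets, so closure
  is the only thing to verify for a subset of \<open>dists S\<close>.\<close>

lemma convex_set_dist_join:
  assumes "A \<subseteq> dists S" and closed: "\<And>Q. Q \<in> dists A \<Longrightarrow> dist_join Q \<in> A"
  shows "convex_set A dist_join"
proof
  show "dist_join (dist_unit a) = a" for a :: "'a \<Rightarrow> 'b"
    by (simp add: fun_eq_iff dist_join_eq_expect dist_expect_unit)
  show "dist_join (dist_join P) = dist_join (dist_push dist_join P)" if "P \<in> dists (dists A)" for P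
    using that
    by (simp add: fun_eq_iff dist_join_eq_expect[of "dist_join P"] dist_join_eq_expect[of "dist_push _ _"]
        dist_expect_push dists_finite_support dist_expect_join_dists[OF _ order_refl])
      (simp add: dist_join_eq_expect)
qed (rule closed)

lemma convex_set_dists: "convex_set (dists S) dist_join"
  by (rule convex_set_dist_join[OF order_refl dist_join_in_dists])

text \<open>The inverse of a bijective algebra map is itself an algebra map: applying
  \<open>f\<close> to the image of \<open>dist_push g Q\<close> recovers \<open>\<kappa> Q\<close>,
  because \<open>f\<close> undoes \<open>g\<close> on the support of \<open>Q\<close>.\<close>

lemma convex_isoI:
  assumes A: "convex_set A \<nu>" and B: "convex_set B \<kappa>" and f: "convex_map A \<nu> B \<kappa> f"
    and g: "g \<in> B \<rightarrow> A" and gf: "\<And>a. a \<in> A \<Longrightarrow> g (f a) = a" and fg: "\<And>b. b \<in> B \<Longrightarrow> f (g b) = b"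
  shows "convex_iso A \<nu> B \<kappa> f"
proof -
  have "g (\<kappa> Q) = \<nu> (dist_push g Q)" if Q: "Q \<in> dists B" for Q
  proof -
    have gQ: "dist_push g Q \<in> dists A" using Q g by (blast intro: dist_push_in_dists)
    have "f (\<nu> (dist_push g Q)) = \<kappa> (dist_push f (dist_push g Q))"
      using f gQ by (simp add: convex_map_def)
    also have "dist_push f (dist_push g Q) = dist_push (\<lambda>b. f (g b)) Q"
      using Q by (simp add: dist_push_push dists_finite_support)
    also have "\<dots> = Q"
      using Q fg by (intro dist_push_ident) (auto dest: dists_support)
    finally show ?thesis using gf[OF convex_set.closed[OF A gQ]] by simp
  qed
  then have "convex_map B \<kappa> A \<nu> g" using g by (simp add: convex_map_def)
  then show ?thesis using assms unfolding convex_iso_def by blast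
qed

lemma convex_isomorphic_sym:
  "convex_isomorphic A \<nu> B \<kappa> \<Longrightarrow> convex_isomorphic B \<kappa> A \<nu>"
  unfolding convex_isomorphic_def convex_iso_def by blast

lemma convex_map_comp:
  fixes \<nu> :: "('a \<Rightarrow> 'r::{comm_semiring_0, comm_monoid_mult}) \<Rightarrow> 'a"
  assumes f: "convex_map A \<nu> B \<kappa> f" and g: "convex_map B \<kappa> C \<xi> g"
  shows "convex_map A \<nu> C \<xi> (\<lambda>a. g (f a))"
  unfolding convex_map_def
proof (intro conjI ballI)
  show "(\<lambda>a. g (f a)) \<in> A \<rightarrow> C" using f g by (auto simp: convex_map_def)
  fix Q :: "'a \<Rightarrow> 'r" assume Q: "Q \<in> dists A"
  then have "dist_push f Q \<in> dists B"
    using f by (auto simp: convex_map_def intro: dist_push_in_dists)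
  then show "g (f (\<nu> Q)) = \<xi> (dist_push (\<lambda>a. g (f a)) Q)"
    using f g Q by (simp add: convex_map_def dist_push_push dists_finite_support)
qed

lemma convex_isomorphic_trans:
  assumes "convex_isomorphic A \<nu> B \<kappa>" and "convex_isomorphic B \<kappa> C \<xi>"
  shows "convex_isomorphic A \<nu> C \<xi>"
proof -
  obtain f f' where f: "convex_set A \<nu>" "convex_map A \<nu> B \<kappa> f" "convex_map B \<kappa> A \<nu> f'"
    "\<forall>a\<in>A. f' (f a) = a" "\<forall>b\<in>B. f (f' b) = b"
    using assms(1) unfolding convex_isomorphic_def convex_iso_def by blast
  obtain g g' where g: "convex_set C \<xi>" "convex_map B \<kappa> C \<xi> g" "convex_map C \<xi> B \<kappa> g'"
    "\<forall>a\<in>B. g' (g a) = a" "\<forall>b\<in>C. g (g' b) = b"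
    using assms(2) unfolding convex_isomorphic_def convex_iso_def by blast
  have "f \<in> A \<rightarrow> B" "g' \<in> C \<rightarrow> B" using f g by (auto simp: convex_map_def)
  then have "convex_iso A \<nu> C \<xi> (\<lambda>a. g (f a))"
    unfolding convex_iso_def
    using f g convex_map_comp[OF f(2) g(2)] convex_map_comp[OF g(3) f(3)]
    by (intro conjI exI[of _ "\<lambda>c. f' (g' c)"]) (simp_all add: Pi_iff)
  then show ?thesis unfolding convex_isomorphic_def by blast
qed


section \<open>The convex set of face maps\<close>

lemma maps_join_apply:
  "x \<in> simplices X n \<Longrightarrow> maps_join X Q n x y = dist_expect Q (\<lambda>p. p n x y)"
  by (simp add: maps_join_def dist_expect_def)

text \<open>Evaluation at \<open>x\<close> turns a distribution on maps into a distribution on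
  distributions, so the pointwise structure reduces to the monad multiplication.\<close>

lemma maps_join_eq_dist_join:
  assumes "finite {p. Q p \<noteq> 0}" and "x \<in> simplices X n"
  shows "maps_join X Q n x = dist_join (dist_push (\<lambda>p. p n x) Q)"
  by (rule ext) (simp add: maps_join_apply dist_join_eq_expect dist_expect_push assms)

lemma maps_join_in_dists:
  assumes "Q \<in> dists A" and "x \<in> simplices X n" and "\<And>p. p \<in> A \<Longrightarrow> p n x \<in> dists S"
  shows "maps_join X Q n x \<in> dists S"
  unfolding maps_join_eq_dist_join[OF dists_finite_support[OF assms(1)] assms(2)]
  using assms by (blast intro: dist_join_in_dists dist_push_in_dists)

lemma dist_push_maps_join:
  assumes Q: "Q \<in> dists A" and x: "x \<in> simplices X n" and A: "\<And>p. p \<in> A \<Longrightarrow> p n x \<in> dists S"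
  shows "dist_push f (maps_join X Q n x) t = dist_expect Q (\<lambda>p. dist_push f (p n x) t)"
proof -
  have fin: "finite {p. Q p \<noteq> 0}" by (rule dists_finite_support[OF Q])
  have "dist_push (\<lambda>p. p n x) Q \<in> dists (dists S)"
    using Q A by (rule dist_push_in_dists)
  then show ?thesis
    unfolding maps_join_eq_dist_join[OF fin x]
    by (simp add: dist_push_join dist_expect_push[OF fin])
qed

lemma sset_mapsD:
  assumes "p \<in> sset_maps X Y"
  shows "\<And>n x. x \<in> simplices X n \<Longrightarrow> p n x \<in> simplices Y n"
    and "\<And>n x. x \<notin> simplices X n \<Longrightarrow> p n x = undefined"
    and "\<And>n x i. x \<in> simplices X (Suc n) \<Longrightarrow> i \<le> Suc n \<Longrightarrow>
      p n (face X (Suc n) i x) = face Y (Suc n) i (p (Suc n) x)"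
    and "\<And>n x j. x \<in> simplices X n \<Longrightarrow> j \<le> n \<Longrightarrow>
      p (Suc n) (degen X n j x) = degen Y n j (p n x)"
proof -
  have *: "p n \<in> simplices X n \<rightarrow>\<^sub>E simplices Y n" for n
    using assms unfolding sset_maps_def by blast
  show "\<And>n x. x \<in> simplices X n \<Longrightarrow> p n x \<in> simplices Y n"
    by (rule PiE_mem[OF *])
  show "\<And>n x. x \<notin> simplices X n \<Longrightarrow> p n x = undefined"
    by (rule PiE_arb[OF *])
qed (use assms in \<open>unfold sset_maps_def, blast+\<close>)

lemma FaceD:
  assumes "p \<in> Face X Y \<phi>"
  shows "\<And>n x. x \<in> simplices X n \<Longrightarrow> p n x \<in> dists (simplices Y (Suc n))"
    and "\<And>n x. x \<notin> simplices X n \<Longrightarrow> p n x = undefined"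
    and "\<And>n x i. x \<in> simplices X (Suc n) \<Longrightarrow> i \<le> Suc n \<Longrightarrow>
      p n (face X (Suc n) i x) = dist_push (face Y (Suc (Suc n)) (Suc i)) (p (Suc n) x)"
    and "\<And>n x j. x \<in> simplices X n \<Longrightarrow> j \<le> n \<Longrightarrow>
      p (Suc n) (degen X n j x) = dist_push (degen Y (Suc n) (Suc j)) (p n x)"
    and "\<And>n x. x \<in> simplices X n \<Longrightarrow> dist_push (face Y (Suc n) 0) (p n x) = dist_unit (\<phi> n x)"
proof -
  have "p \<in> sset_maps X (dist_sset (dec0 Y))" using assms by (simp add: Face_def)
  note * = sset_mapsD[OF this, unfolded dist_sset_def dec0_def, simplified]
  show "\<And>n x. x \<in> simplices X n \<Longrightarrow> p n x \<in> dists (simplices Y (Suc n))"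
    and "\<And>n x. x \<notin> simplices X n \<Longrightarrow> p n x = undefined"
    and "\<And>n x i. x \<in> simplices X (Suc n) \<Longrightarrow> i \<le> Suc n \<Longrightarrow>
      p n (face X (Suc n) i x) = dist_push (face Y (Suc (Suc n)) (Suc i)) (p (Suc n) x)"
    and "\<And>n x j. x \<in> simplices X n \<Longrightarrow> j \<le> n \<Longrightarrow>
      p (Suc n) (degen X n j x) = dist_push (degen Y (Suc n) (Suc j)) (p n x)"
    by (fact *)+
  show "\<And>n x. x \<in> simplices X n \<Longrightarrow> dist_push (face Y (Suc n) 0) (p n x) = dist_unit (\<phi> n x)"
    using assms by (simp add: Face_def)
qed

lemma FaceI:
  assumes "\<And>n x. x \<in> simplices X n \<Longrightarrow> p n x \<in> dists (simplices Y (Suc n))"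
    and "\<And>n x. x \<notin> simplices X n \<Longrightarrow> p n x = undefined"
    and "\<And>n x i. x \<in> simplices X (Suc n) \<Longrightarrow> i \<le> Suc n \<Longrightarrow>
      p n (face X (Suc n) i x) = dist_push (face Y (Suc (Suc n)) (Suc i)) (p (Suc n) x)"
    and "\<And>n x j. x \<in> simplices X n \<Longrightarrow> j \<le> n \<Longrightarrow>
      p (Suc n) (degen X n j x) = dist_push (degen Y (Suc n) (Suc j)) (p n x)"
    and "\<And>n x. x \<in> simplices X n \<Longrightarrow> dist_push (face Y (Suc n) 0) (p n x) = dist_unit (\<phi> n x)"
  shows "p \<in> Face X Y \<phi>"
proof -
  have "p n \<in> simplices X n \<rightarrow>\<^sub>E dists (simplices Y (Suc n))" for n
    by (rule PiE_I) (use assms(1,2) in auto)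
  then show ?thesis
    unfolding Face_def sset_maps_def dist_sset_def dec0_def
    using assms(3-5) by (simp del: PiE_iff)
qed

text \<open>Compatibility with faces and degeneracies is linear in \<open>p\<close>, so it survives
  taking expectations. The condition on d_0 has a fixed right-hand side, and there the total mass 1
  of \<open>Q\<close> enters.\<close>

lemma (in simplicial_set) maps_join_in_Face:
  fixes Y :: "'y sset"
  assumes Q: "Q \<in> dists (Face X Y \<phi>)"
  shows "maps_join X Q \<in> Face X Y \<phi>"
proof (rule FaceI)
  have push: "dist_push f (maps_join X Q n x) t = dist_expect Q (\<lambda>p. dist_push f (p n x) t)"
    if x: "x \<in> simplices X n" for f :: "'y \<Rightarrow> 'y" and n x t
    by (rule dist_push_maps_join[OF Q x]) (rule FaceD(1)[OF _ x])
  have cong: "dist_expect Q h = dist_expect Q h'" if "\<And>p. p \<in> Face X Y \<phi> \<Longrightarrow> h p = h' p" for h h'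
    by (rule dist_expect_cong) (rule that[OF dists_support[OF Q]])
  show "maps_join X Q n x \<in> dists (simplices Y (Suc n))" if "x \<in> simplices X n" for n x
    by (rule maps_join_in_dists[OF Q that]) (rule FaceD(1)[OF _ that])
  show "maps_join X Q n x = undefined" if "x \<notin> simplices X n" for n x
    using that by (simp add: maps_join_def)
  show "maps_join X Q n (face X (Suc n) i x) =
      dist_push (face Y (Suc (Suc n)) (Suc i)) (maps_join X Q (Suc n) x)"
    if x: "x \<in> simplices X (Suc n)" and i: "i \<le> Suc n" for n x i
    by (rule ext, unfold push[OF x] maps_join_apply[OF face_closed[OF x i]], rule cong)
      (simp add: FaceD(3)[OF _ x i])
  show "maps_join X Q (Suc n) (degen X n j x) =
      dist_push (degen Y (Suc n) (Suc j)) (maps_join X Q n x)"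
    if x: "x \<in> simplices X n" and j: "j \<le> n" for n x j
    by (rule ext, unfold push[OF x] maps_join_apply[OF degen_closed[OF x j]], rule cong)
      (simp add: FaceD(4)[OF _ x j])
  show "dist_push (face Y (Suc n) 0) (maps_join X Q n x) = dist_unit (\<phi> n x)"
    if x: "x \<in> simplices X n" for n x
  proof
    fix t
    \<comment> \<open>The factor 1 is written out so that the constant can be pulled out of the
      expectation, leaving the total mass of \<open>Q\<close>.\<close>
    have "dist_push (face Y (Suc n) 0) (maps_join X Q n x) t =
        dist_expect Q (\<lambda>p. 1 * dist_unit (\<phi> n x) t)"
      unfolding push[OF x] by (rule cong) (simp add: FaceD(5)[OF _ x])
    also have "\<dots> = dist_expect Q (\<lambda>_. 1) * dist_unit (\<phi> n x) t"
      by (rule dist_expect_mult_right[symmetric])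
    finally show "dist_push (face Y (Suc n) 0) (maps_join X Q n x) t = dist_unit (\<phi> n x) t"
      by (simp add: dists_total[OF Q])
  qed
qed

lemma (in simplicial_set) convex_set_Face:
  fixes Y :: "'y sset"
  shows "convex_set
    (Face X Y \<phi> :: (nat \<Rightarrow> 'x \<Rightarrow> 'y \<Rightarrow> 'r::{comm_semiring_0, comm_monoid_mult}) set) (maps_join X)"
proof
  fix p :: "nat \<Rightarrow> 'x \<Rightarrow> 'y \<Rightarrow> 'r" assume p: "p \<in> Face X Y \<phi>"
  show "maps_join X (dist_unit p) = p"
  proof (rule ext, rule ext)
    fix n x
    show "maps_join X (dist_unit p) n x = p n x"
    proof (cases "x \<in> simplices X n")
      case True
      then show ?thesis by (intro ext) (simp add: maps_join_apply dist_expect_unit)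
    qed (simp add: maps_join_def FaceD(2)[OF p])
  qed
next
  fix P :: "((nat \<Rightarrow> 'x \<Rightarrow> 'y \<Rightarrow> 'r) \<Rightarrow> 'r) \<Rightarrow> 'r" assume P: "P \<in> dists (dists (Face X Y \<phi>))"
  show "maps_join X (dist_join P) = maps_join X (dist_push (maps_join X) P)"
  proof (rule ext, rule ext)
    fix n x
    show "maps_join X (dist_join P) n x = maps_join X (dist_push (maps_join X) P) n x"
    proof (cases "x \<in> simplices X n")
      case True
      then show ?thesis
        by (intro ext)
          (simp add: maps_join_apply dist_expect_join_dists[OF P order_refl]
            dist_expect_push[OF dists_finite_support[OF P]])
    qed (simp add: maps_join_def)
  qed
qed (rule maps_join_in_Face)


section \<open>Vertices and edges of simplices labelled by a nerve\<close>

locale nerve_map = comm_group G + simplicial_set X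
  for G :: "('g, 'm) monoid_scheme" (structure) and X :: "'x sset" +
  fixes \<phi> :: "nat \<Rightarrow> 'x \<Rightarrow> 'g list"
  assumes nerve_map: "\<phi> \<in> sset_maps X (nerve G)"
begin

lemma nerve_map_simplex:
  assumes "x \<in> simplices X n"
  shows "length (\<phi> n x) = n \<and> set (\<phi> n x) \<subseteq> carrier G"
proof -
  have "\<phi> n \<in> simplices X n \<rightarrow>\<^sub>E simplices (nerve G) n"
    using nerve_map unfolding sset_maps_def by blast
  then have "\<phi> n x \<in> simplices (nerve G) n" using assms by (rule PiE_mem)
  then show ?thesis by (simp add: nerve_def)
qed

lemma nerve_map_face:
  assumes "x \<in> simplices X (Suc n)" "i \<le> Suc n"
  shows "\<phi> n (face X (Suc n) i x) = nerve_face G (Suc n) i (\<phi> (Suc n) x)"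
proof -
  have "\<phi> n (face X (Suc n) i x) = face (nerve G) (Suc n) i (\<phi> (Suc n) x)"
    using nerve_map assms unfolding sset_maps_def by blast
  then show ?thesis by (simp add: nerve_def)
qed

lemma nerve_map_degen:
  assumes "x \<in> simplices X n" "j \<le> n"
  shows "\<phi> (Suc n) (degen X n j x) = take j (\<phi> n x) @ [\<one>] @ drop j (\<phi> n x)"
proof -
  have "\<phi> (Suc n) (degen X n j x) = degen (nerve G) n j (\<phi> n x)"
    using nerve_map assms unfolding sset_maps_def by blast
  then show ?thesis by (simp add: nerve_def)
qed

lemma nerve_map_edge: "\<sigma> \<in> simplices X 1 \<Longrightarrow> \<phi> 1 \<sigma> = [hd (\<phi> 1 \<sigma>)]"
  using nerve_map_simplex[of \<sigma> 1] by (cases "\<phi> 1 \<sigma>") auto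

lemma nerve_map_edge_carrier: "\<sigma> \<in> simplices X 1 \<Longrightarrow> hd (\<phi> 1 \<sigma>) \<in> carrier G"
  using nerve_map_simplex[of \<sigma> 1] by (cases "\<phi> 1 \<sigma>") auto

lemma face_edge: "\<sigma> \<in> simplices X 1 \<Longrightarrow> i \<le> 1 \<Longrightarrow> face X 1 i \<sigma> \<in> simplices X 0"
  using face_closed[of \<sigma> 0 i] by simp

text \<open>Taking the last face repeatedly strips all vertices but the initial one. The dimension
  is an argument because an element of the type may be a simplex in several dimensions.\<close>

fun first_vertex :: "nat \<Rightarrow> 'x \<Rightarrow> 'x" where
  "first_vertex 0 x = x"
| "first_vertex (Suc n) x = first_vertex n (face X (Suc n) (Suc n) x)"

lemma first_vertex_closed: "x \<in> simplices X n \<Longrightarrow> first_vertex n x \<in> simplices X 0"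
  by (induction n arbitrary: x) (auto intro: face_closed)

text \<open>Among the faces only d_0 removes the initial vertex. A face with positive index is
  either the last one, as in the recursion, or commutes with the last one.\<close>

lemma first_vertex_face:
  "x \<in> simplices X (Suc n) \<Longrightarrow> 0 < i \<Longrightarrow> i \<le> Suc n \<Longrightarrow>
    first_vertex n (face X (Suc n) i x) = first_vertex (Suc n) x"
proof (induction n arbitrary: x i)
  case 0
  then have "i = 1" by simp
  then show ?case by simp
next
  case (Suc n)
  show ?case
  proof (cases "i = Suc (Suc n)")
    case False
    then have "face X (Suc n) (Suc n) (face X (Suc (Suc n)) i x) =
        face X (Suc n) i (face X (Suc (Suc n)) (Suc (Suc n)) x)"
      using face_face[of x n i "Suc (Suc n)"] Suc.prems by simp
    then show ?thesis
      using False Suc.prems Suc.IH[of "face X (Suc (Suc n)) (Suc (Suc n)) x" i]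
      by (simp add: face_closed)
  qed simp
qed

text \<open>The face of index \<open>Suc j\<close> undoes the j-th degeneracy, and its index is
  positive, so it keeps the first vertex.\<close>

lemma first_vertex_degen:
  assumes "x \<in> simplices X n" "j \<le> n"
  shows "first_vertex (Suc n) (degen X n j x) = first_vertex n x"
  using first_vertex_face[of "degen X n j x" n "Suc j"] face_degen_same[of x n j "Suc j"] assms
  by (simp add: degen_closed del: first_vertex.simps)

text \<open>The edge joining the first two vertices of \<open>x\<close>, reached by last faces. It
  reduces the effect of d_0 on a simplex of any dimension to that of a single labelled edge.\<close>

lemma first_edge:
  assumes "x \<in> simplices X (Suc n)"
  obtains e where "e \<in> simplices X 1" "face X 1 1 e = first_vertex (Suc n) x"
    "face X 1 0 e = first_vertex n (face X (Suc n) 0 x)" "hd (\<phi> 1 e) = hd (\<phi> (Suc n) x)"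
proof -
  have "\<exists>e \<in> simplices X 1. face X 1 1 e = first_vertex (Suc n) x \<and>
    face X 1 0 e = first_vertex n (face X (Suc n) 0 x) \<and> hd (\<phi> 1 e) = hd (\<phi> (Suc n) x)"
    using assms
  proof (induction n arbitrary: x)
    case 0
    then show ?case by (intro bexI[of _ x]) auto
  next
    case (Suc n)
    let ?y = "face X (Suc (Suc n)) (Suc (Suc n)) x"
    have "\<phi> (Suc n) ?y = butlast (\<phi> (Suc (Suc n)) x)"
      using Suc.prems by (simp add: nerve_map_face nerve_face_def)
    moreover have "length (\<phi> (Suc (Suc n)) x) = Suc (Suc n)"
      using nerve_map_simplex[OF Suc.prems] by simp
    ultimately have "hd (\<phi> (Suc n) ?y) = hd (\<phi> (Suc (Suc n)) x)"
      by (cases "\<phi> (Suc (Suc n)) x") auto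
    moreover have "face X (Suc n) 0 ?y = face X (Suc n) (Suc n) (face X (Suc (Suc n)) 0 x)"
      using face_face[of x n 0 "Suc (Suc n)"] Suc.prems by simp
    ultimately show ?case
      using Suc.IH[of ?y] Suc.prems by (simp add: face_closed)
  qed
  then show ?thesis using that by blast
qed


section \<open>Walks and the circle subgroup\<close>

abbreviation H where "H \<equiv> circle_subgroup G X \<phi>"

definition step_value :: "'x \<times> nat \<Rightarrow> 'g" where
  "step_value = (\<lambda>(\<sigma>, i). if i = 1 then hd (\<phi> 1 \<sigma>) else inv (hd (\<phi> 1 \<sigma>)))"

text \<open>The index convention is that of circles, the pair naming an edge and the face at which
  it is entered. Edges may repeat, so walks can be concatenated freely.\<close>

fun walk :: "'x \<Rightarrow> ('x \<times> nat) list \<Rightarrow> 'x \<Rightarrow> bool" where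
  "walk u [] v \<longleftrightarrow> u = v"
| "walk u ((\<sigma>, i) # es) v \<longleftrightarrow>
     \<sigma> \<in> simplices X 1 \<and> i \<in> {0, 1} \<and> u = face X 1 i \<sigma> \<and> walk (face X 1 (1 - i) \<sigma>) es v"

definition walk_value :: "('x \<times> nat) list \<Rightarrow> 'g" where
  "walk_value es = foldr (\<lambda>e a. step_value e \<otimes> a) es \<one>"

lemma walk_value_simps [simp]:
  "walk_value [] = \<one>" "walk_value (e # es) = step_value e \<otimes> walk_value es"
  by (simp_all add: walk_value_def)

lemma walk_append: "walk u (es @ es') v \<longleftrightarrow> (\<exists>w. walk u es w \<and> walk w es' v)"
  by (induction u es v rule: walk.induct) auto

lemma step_value_carrier: "\<sigma> \<in> simplices X 1 \<Longrightarrow> step_value (\<sigma>, i) \<in> carrier G"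
  by (simp add: step_value_def nerve_map_edge_carrier del: One_nat_def)

lemma walk_value_carrier: "walk u es v \<Longrightarrow> walk_value es \<in> carrier G"
  by (induction u es v rule: walk.induct) (auto simp: step_value_carrier)

lemma walk_value_append:
  "walk u es v \<Longrightarrow> walk v es' w \<Longrightarrow> walk_value (es @ es') = walk_value es \<otimes> walk_value es'"
  by (induction u es v rule: walk.induct) (auto simp: step_value_carrier walk_value_carrier m_assoc)

lemma circle_value_carrier:
  assumes "circle X n \<sigma> \<iota>" shows "circle_value G \<phi> n \<sigma> \<iota> \<in> carrier G"
proof -
  have "\<sigma> k \<in> simplices X 1" if "k \<in> {1..n}" for k
    using assms that by (auto simp: circle_def)
  then show ?thesis
    unfolding circle_value_def
    by (intro finprod_closed) (auto simp: nerve_map_edge_carrier simp del: One_nat_def)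
qed

lemma subgroup_H: "subgroup H G"
  unfolding circle_subgroup_def by (rule generate_is_subgroup) (auto intro: circle_value_carrier)

lemma H_carrier: "h \<in> H \<Longrightarrow> h \<in> carrier G"
  using subgroup.mem_carrier[OF subgroup_H] .

text \<open>Circle values are unordered products, hence the use of commutativity. Positions count
  from 1 in circles and from 0 in lists, which explains \<open>k - 1\<close>; induction from the
  right end makes the index set grow by its last element.\<close>

lemma walk_value_eq_finprod:
  "walk u es v \<Longrightarrow> walk_value es = (\<Otimes>k \<in> {1..length es}. step_value (es ! (k - 1)))"
proof (induction es arbitrary: v rule: rev_induct)
  case (snoc e es)
  obtain \<sigma> i where e: "e = (\<sigma>, i)" by (cases e)
  obtain w where w: "walk u es w" and e': "walk w [e] v"
    using snoc.prems by (auto simp: walk_append)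
  have \<sigma>: "\<sigma> \<in> simplices X 1" using e' e by simp
  have c: "step_value (es ! k) \<in> carrier G" if "k < length es" for k
    using that w
  proof (induction u es w arbitrary: k rule: walk.induct)
    case (2 u \<tau> j es v)
    then show ?case by (cases k) (auto simp: step_value_carrier)
  qed simp
  have "{1..length (es @ [e])} = insert (Suc (length es)) {1..length es}" by auto
  then have "(\<Otimes>k \<in> {1..length (es @ [e])}. step_value ((es @ [e]) ! (k - 1))) =
      step_value e \<otimes> (\<Otimes>k \<in> {1..length es}. step_value ((es @ [e]) ! (k - 1)))"
    using c \<sigma> e by (simp add: nth_append step_value_carrier Pi_iff)
  also have "(\<Otimes>k \<in> {1..length es}. step_value ((es @ [e]) ! (k - 1))) = walk_value es"
    unfolding snoc.IH[OF w] using c by (intro finprod_cong') (auto simp: nth_append)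
  finally show ?case
    using walk_value_append[OF w e'] walk_value_carrier[OF w] \<sigma> e
    by (simp add: m_comm step_value_carrier)
qed simp

lemma walk_nth:
  "walk u es v \<Longrightarrow> k < length es \<Longrightarrow> fst (es ! k) \<in> simplices X 1 \<and> snd (es ! k) \<in> {0, 1}"
proof (induction u es v arbitrary: k rule: walk.induct)
  case (2 u \<tau> j es v)
  then show ?case by (cases k) auto
qed simp

lemma walk_hd: "walk u es v \<Longrightarrow> es \<noteq> [] \<Longrightarrow> u = face X 1 (snd (hd es)) (fst (hd es))"
  by (cases es) auto

lemma walk_last: "walk u es v \<Longrightarrow> es \<noteq> [] \<Longrightarrow> v = face X 1 (1 - snd (last es)) (fst (last es))"
  by (induction u es v rule: walk.induct) (auto split: if_splits)

lemma walk_consecutive: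
  assumes "walk u es v" "Suc k < length es"
  shows "face X 1 (1 - snd (es ! k)) (fst (es ! k)) = face X 1 (snd (es ! Suc k)) (fst (es ! Suc k))"
proof -
  have "es = take (Suc k) es @ drop (Suc k) es" by simp
  then obtain w where w: "walk u (take (Suc k) es) w" "walk w (drop (Suc k) es) v"
    using assms(1) by (metis walk_append)
  have "last (take (Suc k) es) = es ! k" "hd (drop (Suc k) es) = es ! Suc k"
    using assms(2) by (simp_all add: take_Suc_conv_app_nth hd_drop_conv_nth)
  then show ?thesis
    using walk_last[OF w(1)] walk_hd[OF w(2)] assms(2) by force
qed

text \<open>Distinctness is asked of the edges alone, not of the pairs with their directions, since
  a circle uses each edge at most once in either direction.\<close>

lemma walk_to_circle:
  assumes "walk v es v" "es \<noteq> []" "distinct (map fst es)"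
  shows "circle X (length es) (\<lambda>k. fst (es ! (k - 1))) (\<lambda>k. snd (es ! (k - 1)))"
  unfolding circle_def
proof (intro conjI ballI)
  show "inj_on (\<lambda>k. fst (es ! (k - 1))) {1..length es}"
  proof (rule inj_onI)
    fix k l assume *: "k \<in> {1..length es}" "l \<in> {1..length es}" "fst (es ! (k - 1)) = fst (es ! (l - 1))"
    then have "k - 1 = l - 1"
      using nth_eq_iff_index_eq[OF assms(3), of "k - 1" "l - 1"] by auto
    then show "k = l" using * by auto
  qed
  show "face X 1 (1 - snd (es ! (k - 1))) (fst (es ! (k - 1))) =
      face X 1 (snd (es ! (k + 1 - 1))) (fst (es ! (k + 1 - 1)))" if "k \<in> {1..<length es}" for k
    using walk_consecutive[OF assms(1), of "k - 1"] that by auto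
  show "face X 1 (snd (es ! (1 - 1))) (fst (es ! (1 - 1))) =
      face X 1 (1 - snd (es ! (length es - 1))) (fst (es ! (length es - 1)))"
    using walk_hd[OF assms(1,2)] walk_last[OF assms(1,2)] assms(2)
    by (simp add: hd_conv_nth last_conv_nth)
  show "1 \<le> length es" using assms(2) by (simp add: Suc_le_eq)
  show "(\<lambda>k. fst (es ! (k - 1))) \<in> {1..length es} \<rightarrow> simplices X 1"
    "(\<lambda>k. snd (es ! (k - 1))) \<in> {1..length es} \<rightarrow> {0, 1}"
    using walk_nth[OF assms(1)]
      by (fastforce, intro Pi_I, metis One_nat_def Suc_pred' atLeastAtMost_iff less_eq_Suc_le)
qed

text \<open>
  At a repeated edge a closed walk splits into two shorter closed walks; if the edge is traversed in
  opposite directions, its two contributions cancel.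
\<close>

lemma closed_walk_value: "walk v es v \<Longrightarrow> walk_value es \<in> H"
proof (induction "length es" arbitrary: v es rule: less_induct)
  case less
  note subgroup.m_closed[OF subgroup_H, intro]
  show ?case
  proof (cases "distinct (map fst es)")
    case True
    show ?thesis
    proof (cases "es = []")
      case False
      note circ = walk_to_circle[OF less.prems False True]
      have "walk_value es =
          circle_value G \<phi> (length es) (\<lambda>k. fst (es ! (k - 1))) (\<lambda>k. snd (es ! (k - 1)))"
        unfolding walk_value_eq_finprod[OF less.prems] circle_value_def step_value_def
        by (simp only: case_prod_beta)
      then show ?thesis
        unfolding circle_subgroup_def using circ by (auto intro!: generate.incl)
    qed (simp add: subgroup.one_closed[OF subgroup_H])
  next
    case False
    then obtain xs ys zs \<sigma> where "map fst es = xs @ [\<sigma>] @ ys @ [\<sigma>] @ zs"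
      using not_distinct_decomp by blast
    \<comment> \<open>The decomposition of the list of edges is lifted back to the walk, whose two
      passages along \<open>\<sigma>\<close> may carry different indices.\<close>
    then obtain as es' where "es = as @ es'" "map fst es' = \<sigma> # ys @ \<sigma> # zs"
      by (auto simp: map_eq_append_conv)
    moreover from this obtain i es'' where "es' = (\<sigma>, i) # es''" "map fst es'' = ys @ \<sigma> # zs"
      by (auto simp: map_eq_Cons_conv)
    moreover from this obtain bs es3 where "es'' = bs @ es3" "map fst es3 = \<sigma> # zs"
      by (auto simp: map_eq_append_conv)
    moreover from this obtain j cs where "es3 = (\<sigma>, j) # cs"
      by (auto simp: map_eq_Cons_conv)
    ultimately have es: "es = as @ (\<sigma>, i) # bs @ (\<sigma>, j) # cs" by simp
    then have as: "walk v as (face X 1 i \<sigma>)" and bs: "walk (face X 1 (1 - i) \<sigma>) bs (face X 1 j \<sigma>)"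
      and cs: "walk (face X 1 (1 - j) \<sigma>) cs v" and \<sigma>: "\<sigma> \<in> simplices X 1" and ij: "i \<in> {0, 1}" "j \<in> {0, 1}"
      using less.prems by (auto simp: walk_append)
    note carr [simp] = walk_value_carrier[OF as] walk_value_carrier[OF bs] walk_value_carrier[OF cs]
      step_value_carrier[OF \<sigma>]
    have "walk (face X 1 (1 - i) \<sigma>) (bs @ (\<sigma>, j) # cs) v"
      using bs cs \<sigma> ij by (auto simp: walk_append)
    then have val: "walk_value es = walk_value as \<otimes> (step_value (\<sigma>, i) \<otimes>
        (walk_value bs \<otimes> (step_value (\<sigma>, j) \<otimes> walk_value cs)))"
      unfolding es using as bs cs \<sigma> ij
      by (subst walk_value_append[OF as, of _ v]; simp)
        (subst walk_value_append[OF bs, of _ v]; simp)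
    show ?thesis
    proof (cases "i = j")
      case True
      \<comment> \<open>The inner loop takes the first passage along \<open>\<sigma>\<close> and the
        outer walk keeps the second, so no factor is lost and both closed walks are shorter.\<close>
      have "walk_value ((\<sigma>, i) # bs) \<in> H"
        using True bs \<sigma> ij es by (intro less.hyps[of _ "face X 1 i \<sigma>"]) auto
      moreover have wcs: "walk (face X 1 i \<sigma>) ((\<sigma>, j) # cs) v" using True cs \<sigma> ij by simp
      then have "walk_value (as @ (\<sigma>, j) # cs) \<in> H"
        using as es by (intro less.hyps[of _ v]) (auto simp: walk_append)
      ultimately have "(step_value (\<sigma>, i) \<otimes> walk_value bs) \<otimes>
          (walk_value as \<otimes> (step_value (\<sigma>, j) \<otimes> walk_value cs)) \<in> H"
        using walk_value_append[OF as wcs] by auto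
      then show ?thesis unfolding val by (simp add: m_ac)
    next
      case False
      then have j: "j = 1 - i" "i = 1 - j" using ij by auto
      \<comment> \<open>Now \<open>bs\<close> is a loop at the far end of \<open>\<sigma>\<close>,
        and \<open>as\<close> can be continued directly by \<open>cs\<close>; both passages along
        \<open>\<sigma>\<close> are dropped.\<close>
      then have cs': "walk (face X 1 i \<sigma>) cs v" and bs': "walk (face X 1 j \<sigma>) bs (face X 1 j \<sigma>)"
        using bs cs by auto
      have "walk_value bs \<in> H"
        using es by (intro less.hyps[OF _ bs']) auto
      moreover have "walk_value (as @ cs) \<in> H"
        using as cs' es by (intro less.hyps[of _ v]) (auto simp: walk_append)
      ultimately have "walk_value bs \<otimes> (walk_value as \<otimes> walk_value cs) \<in> H"
        using walk_value_append[OF as cs'] by auto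
      moreover have inv: "step_value (\<sigma>, i) \<otimes> step_value (\<sigma>, j) = \<one>"
        using False ij nerve_map_edge_carrier[OF \<sigma>] by (auto simp: step_value_def)
      have "walk_value es = (step_value (\<sigma>, i) \<otimes> step_value (\<sigma>, j)) \<otimes>
          (walk_value bs \<otimes> (walk_value as \<otimes> walk_value cs))"
        unfolding val by (simp add: m_ac)
      ultimately show ?thesis by (simp add: inv)
    qed
  qed
qed

section \<open>Connectedness, circles as closed walks, and potentials\<close>

lemma connected_nonempty: "sset_connected X \<Longrightarrow> simplices X 0 \<noteq> {}"
  by (auto simp: sset_connected_def path_components_def is_singleton_def)

lemma connected_walk:
  assumes "sset_connected X" and u: "u \<in> simplices X 0" and v: "v \<in> simplices X 0"
  obtains es where "walk u es v"
proof -
  let ?R = "(edge_rel X \<union> (edge_rel X)\<inverse>)\<^sup>*"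
  obtain C where "simplices X 0 // ?R = {C}"
    using assms by (auto simp: sset_connected_def path_components_def is_singleton_def)
  then have "?R `` {u} = C" "?R `` {v} = C"
    using u v by (auto simp: quotient_def)
  then have "(u, v) \<in> ?R" by blast
  then have "\<exists>es. walk u es v"
  proof induction
    case base
    show ?case by (intro exI[of _ "[]"]) simp
  next
    case (step y z)
    obtain es where es: "walk u es y" using step.IH by blast
    obtain \<sigma> i where "\<sigma> \<in> simplices X 1" "i \<in> {0, 1}" "y = face X 1 i \<sigma>" "z = face X 1 (1 - i) \<sigma>"
      using step.hyps(2) unfolding edge_rel_def by fastforce
    then have "walk u (es @ [(\<sigma>, i)]) z" using es by (auto simp: walk_append)
    then show ?case by blast
  qed
  then show ?thesis using that by blast
qed

text \<open>This lets transport along walks be applied to the generators of the circle subgroup. The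
  walk is based at the starting face of the first edge, which need not be a vertex fixed in
  advance.\<close>

lemma circle_to_walk:
  assumes circ: "circle X n \<sigma> \<iota>"
  obtains u es where "u \<in> simplices X 0" "walk u es u" "walk_value es = circle_value G \<phi> n \<sigma> \<iota>"
proof -
  let ?u = "face X 1 (\<iota> 1) (\<sigma> 1)" and ?es = "\<lambda>m. map (\<lambda>k. (\<sigma> k, \<iota> k)) [1..<Suc m]"
  have n: "1 \<le> n" and step: "\<And>k. k \<in> {1..n} \<Longrightarrow> \<sigma> k \<in> simplices X 1 \<and> \<iota> k \<in> {0, 1}"
    and consec: "\<And>k. k \<in> {1..<n} \<Longrightarrow> face X 1 (1 - \<iota> k) (\<sigma> k) = face X 1 (\<iota> (k + 1)) (\<sigma> (k + 1))"
    and closed: "?u = face X 1 (1 - \<iota> n) (\<sigma> n)"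
    using circ by (auto simp: circle_def)
  \<comment> \<open>Initial segments end at the far face of their last edge; the closing condition
    is used only for the whole list.\<close>
  have "walk ?u (?es m) (face X 1 (1 - \<iota> m) (\<sigma> m))" if "1 \<le> m" "m \<le> n" for m
    using that
  proof (induction m rule: nat_induct_at_least)
    case base
    then show ?case using step[of 1] n by simp
  next
    case (Suc m)
    then show ?case
      using step[of "Suc m"] consec[of m] by (auto simp: walk_append)
  qed
  from this[OF n order_refl] have walk: "walk ?u (?es n) ?u" by (simp only: closed)
  have "walk_value (?es n) = circle_value G \<phi> n \<sigma> \<iota>"
    unfolding walk_value_eq_finprod[OF walk] circle_value_def
    using step by (intro finprod_cong')
      (auto simp: step_value_def nerve_map_edge_carrier Pi_iff simp del: One_nat_def upt_Suc)
  moreover have "?u \<in> simplices X 0"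
    using step[of 1] n by (intro face_edge) auto
  ultimately show ?thesis using that walk by blast
qed

text \<open>One walk is chosen to each vertex. At \<open>v\<close> the choice is overridden by the
  empty walk, so that no translation is applied at the base vertex.\<close>

lemma potential:
  assumes "sset_connected X" and v: "v \<in> simplices X 0"
  obtains w where "w v = \<one>" "\<And>u. u \<in> simplices X 0 \<Longrightarrow> \<exists>es. walk v es u \<and> w u = walk_value es"
proof -
  have "\<forall>u \<in> simplices X 0. \<exists>es. walk v es u" using connected_walk[OF assms] by metis
  then obtain f where f: "\<forall>u \<in> simplices X 0. walk v (f u) u" by metis
  show ?thesis
  proof (rule that[where w = "\<lambda>u. if u = v then \<one> else walk_value (f u)"])
    show "\<exists>es. walk v es u \<and> (if u = v then \<one> else walk_value (f u)) = walk_value es"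
      if "u \<in> simplices X 0" for u
    proof (cases "u = v")
      case True
      then show ?thesis by (intro exI[of _ "[]"]) simp
    qed (use f that in auto)
  qed simp
qed

text \<open>A common return walk from the end of \<open>\<sigma>\<close> to \<open>v\<close> closes
  up both the chosen walk to that end and the chosen walk to the start followed by
  \<open>\<sigma>\<close>. The quotient of the two closed values is \<open>h\<close>: the potential
  is multiplicative along edges modulo \<open>H\<close>.\<close>

lemma potential_edge:
  assumes conn: "sset_connected X" and v: "v \<in> simplices X 0"
    and w: "\<And>u. u \<in> simplices X 0 \<Longrightarrow> \<exists>es. walk v es u \<and> w u = walk_value es"
    and \<sigma>: "\<sigma> \<in> simplices X 1"
  obtains h where "h \<in> H" "w (face X 1 1 \<sigma>) \<otimes> hd (\<phi> 1 \<sigma>) = h \<otimes> w (face X 1 0 \<sigma>)"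
proof -
  let ?a = "hd (\<phi> 1 \<sigma>)"
  obtain es0 where es0: "walk v es0 (face X 1 0 \<sigma>)" "w (face X 1 0 \<sigma>) = walk_value es0"
    using w face_edge[OF \<sigma>, of 0] by auto
  obtain es1 where es1: "walk v es1 (face X 1 1 \<sigma>)" "w (face X 1 1 \<sigma>) = walk_value es1"
    using w face_edge[OF \<sigma>, of 1] by auto
  obtain es where es: "walk (face X 1 0 \<sigma>) es v"
    using connected_walk[OF conn _ v] face_edge[OF \<sigma>, of 0] by auto
  have \<sigma>es: "walk (face X 1 1 \<sigma>) ((\<sigma>, 1) # es) v" using \<sigma> es by simp
  have carr: "walk_value es0 \<in> carrier G" "walk_value es1 \<in> carrier G" "walk_value es \<in> carrier G"
    "?a \<in> carrier G"
    using es0 es1 es \<sigma> by (auto intro: walk_value_carrier nerve_map_edge_carrier[simplified])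
  have "walk v (es0 @ es) v" "walk v (es1 @ (\<sigma>, 1) # es) v"
    using es0(1) es1(1) es \<sigma>es walk_append by blast+
  then have "walk_value es0 \<otimes> walk_value es \<in> H" "walk_value es1 \<otimes> (?a \<otimes> walk_value es) \<in> H"
    using walk_value_append[OF es0(1) es] walk_value_append[OF es1(1) \<sigma>es]
      closed_walk_value[of v "es0 @ es"] closed_walk_value[of v "es1 @ (\<sigma>, 1) # es"]
    by (auto simp: step_value_def)
  then have "(walk_value es1 \<otimes> (?a \<otimes> walk_value es)) \<otimes> inv (walk_value es0 \<otimes> walk_value es) \<in> H"
    by (blast intro: subgroup.m_closed[OF subgroup_H] subgroup.m_inv_closed[OF subgroup_H])
  moreover have "b \<otimes> (d \<otimes> c) \<otimes> inv (a \<otimes> c) \<otimes> a = b \<otimes> d"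
    if "a \<in> carrier G" "b \<in> carrier G" "c \<in> carrier G" "d \<in> carrier G" for a b c d
  proof -
    \<comment> \<open>A variable stands for the inverse, so that the rearrangement treats it as a
      single factor.\<close>
    have "b \<otimes> (d \<otimes> c) \<otimes> i \<otimes> a = b \<otimes> d \<otimes> (a \<otimes> c \<otimes> i)" if "i \<in> carrier G" for i
      using that \<open>a \<in> _\<close> \<open>b \<in> _\<close> \<open>c \<in> _\<close> \<open>d \<in> _\<close> by (simp add: m_ac)
    from this[of "inv (a \<otimes> c)"] show ?thesis using that by simp
  qed
  ultimately show ?thesis using that es0(2) es1(2) carr by metis
qed


section \<open>Translates of distributions on the group\<close>

abbreviation translate where "translate a q \<equiv> dist_push (\<lambda>g. g \<otimes> a) q"

lemma translate_in_dists:
  "q \<in> dists (carrier G) \<Longrightarrow> a \<in> carrier G \<Longrightarrow> translate a q \<in> dists (carrier G)"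
  by (rule dist_push_in_dists) auto

lemma translate_one: "q \<in> dists (carrier G) \<Longrightarrow> translate \<one> q = q"
  by (rule dist_push_ident) (auto dest: dists_support)

lemma translate_translate:
  assumes "q \<in> dists (carrier G)" "a \<in> carrier G" "b \<in> carrier G"
  shows "translate a (translate b q) = translate (b \<otimes> a) q"
  unfolding dist_push_push[OF dists_finite_support[OF assms(1)]]
  by (rule dist_push_cong) (auto simp: m_assoc assms dest: dists_support[OF assms(1)])

lemma translate_apply:
  assumes "q \<in> dists (carrier G)" "a \<in> carrier G" "g \<in> carrier G"
  shows "translate a q (g \<otimes> a) = q g"
  by (rule dist_push_inj_apply[where S = "carrier G"])
    (use assms in \<open>auto intro: inj_onI dest: dists_support\<close>)

text \<open>Transport along walks acts by push-forward, so invariance is recast as being fixed by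
  translations. Right multiplication is a bijection of the carrier, and off the carrier both sides
  vanish.\<close>

lemma invariant_dists_iff:
  "q \<in> invariant_dists G X \<phi> \<longleftrightarrow> q \<in> dists (carrier G) \<and> (\<forall>h \<in> H. translate h q = q)"
proof (intro iffI conjI ballI)
  assume q: "q \<in> invariant_dists G X \<phi>"
  then show D: "q \<in> dists (carrier G)" by (simp add: invariant_dists_def)
  fix h assume h: "h \<in> H"
  show "translate h q = q"
  proof
    fix t
    show "translate h q t = q t"
    proof (cases "t \<in> carrier G")
      case True
      have inv: "q (g \<otimes> h) = q g" if "g \<in> carrier G" for g
        using q h that by (simp add: invariant_dists_def)
      have "t \<otimes> inv h \<otimes> h = t" using True H_carrier[OF h] by (simp add: m_assoc)
      then show ?thesis
        using translate_apply[OF D H_carrier[OF h], of "t \<otimes> inv h"] True H_carrier[OF h]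
          inv[of "t \<otimes> inv h"]
        by simp
    next
      case False
      then show ?thesis
        using dists_support[OF D] dists_support[OF translate_in_dists[OF D H_carrier[OF h]]] by metis
    qed
  qed
next
  assume q: "q \<in> dists (carrier G) \<and> (\<forall>h \<in> H. translate h q = q)"
  then show "q \<in> invariant_dists G X \<phi>"
    unfolding invariant_dists_def using translate_apply[of q] H_carrier by (simp, metis)
qed

text \<open>Since the stabilizer is a subgroup, invariance under \<open>H\<close> need only be
  checked on the values of circles.\<close>

lemma subgroup_translation_stabilizer:
  assumes "q \<in> dists (carrier G)"
  shows "subgroup {h \<in> carrier G. translate h q = q} G"
proof (rule subgroupI)
  fix a assume a: "a \<in> {h \<in> carrier G. translate h q = q}"
  then have "translate (inv a) (translate a q) = translate \<one> q"
    using translate_translate[OF assms, of "inv a" a] by simp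
  then show "inv a \<in> {h \<in> carrier G. translate h q = q}"
    using a by (simp add: translate_one[OF assms])
next
  fix a b assume "a \<in> {h \<in> carrier G. translate h q = q}" "b \<in> {h \<in> carrier G. translate h q = q}"
  then show "a \<otimes> b \<in> {h \<in> carrier G. translate h q = q}"
    using translate_translate[OF assms, of b a] by simp
next
  show "{h \<in> carrier G. translate h q = q} \<noteq> {}"
    using translate_one[OF assms] by blast
qed auto

lemma convex_set_invariant_dists: "convex_set (invariant_dists G X \<phi>) dist_join"
proof (rule convex_set_dist_join)
  show sub: "invariant_dists G X \<phi> \<subseteq> dists (carrier G)" by (auto simp: invariant_dists_def)
  fix Q :: "('g \<Rightarrow> 'r::{comm_semiring_0, comm_monoid_mult}) \<Rightarrow> 'r"
  assume Q: "Q \<in> dists (invariant_dists G X \<phi>)"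
  have "dist_join Q \<in> dists (carrier G)"
    using Q dists_mono[OF sub] dist_join_in_dists by blast
  moreover have "dist_join Q (g \<otimes> h) = dist_join Q g" if "g \<in> carrier G" "h \<in> H" for g h
    unfolding dist_join_eq_expect using that dists_support[OF Q]
    by (intro dist_expect_cong) (auto simp: invariant_dists_def)
  ultimately show "dist_join Q \<in> invariant_dists G X \<phi>" by (simp add: invariant_dists_def)
qed


section \<open>Face maps as invariant distributions\<close>

text \<open>In the nerve d_0 drops the head. The push-forward along it is the point mass at
  \<open>\<phi> n x\<close> and no weights cancel, so every list in the support has this
  tail.\<close>

lemma Face_support:
  fixes p :: "nat \<Rightarrow> 'x \<Rightarrow> 'g list \<Rightarrow> 'r::{comm_semiring_0, comm_monoid_mult}"
  assumes zsf: "zero_sum_free TYPE('r)" and p: "p \<in> Face X (nerve G) \<phi>"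
    and x: "x \<in> simplices X n" and gs: "p n x gs \<noteq> 0"
  obtains g where "g \<in> carrier G" "gs = g # \<phi> n x"
proof -
  have D: "p n x \<in> dists (simplices (nerve G) (Suc n))" using FaceD(1)[OF p x] .
  then have "gs \<in> simplices (nerve G) (Suc n)" using dists_support gs by metis
  then obtain g l where l: "gs = g # l" "g \<in> carrier G" by (cases gs) (auto simp: nerve_def)
  have "dist_push (face (nerve G) (Suc n) 0) (p n x) l = dist_unit (\<phi> n x) l"
    using FaceD(5)[OF p x] by simp
  moreover have "dist_push (face (nerve G) (Suc n) 0) (p n x) l \<noteq> 0"
    using dist_push_nonzero[OF zsf dists_finite_support[OF D] gs, of "face (nerve G) (Suc n) 0"] l
    by (simp add: nerve_def nerve_face_def)
  ultimately have "l = \<phi> n x" by (auto simp: dist_unit_def split: if_splits)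
  then show ?thesis using that l by blast
qed

lemma Face_hd_in_dists:
  assumes p: "p \<in> Face X (nerve G) \<phi>" and x: "x \<in> simplices X n"
  shows "dist_push hd (p n x) \<in> dists (carrier G)"
  by (rule dist_push_in_dists[OF FaceD(1)[OF p x]])
    (auto simp: nerve_def length_Suc_conv)

text \<open>On the support, taking the head and prepending it to \<open>\<phi> n x\<close> are
  inverse to each other.\<close>

lemma Face_eq_push_hd:
  fixes p :: "nat \<Rightarrow> 'x \<Rightarrow> 'g list \<Rightarrow> 'r::{comm_semiring_0, comm_monoid_mult}"
  assumes zsf: "zero_sum_free TYPE('r)" and p: "p \<in> Face X (nerve G) \<phi>" and x: "x \<in> simplices X n"
  shows "p n x = dist_push (\<lambda>g. g # \<phi> n x) (dist_push hd (p n x))"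
  unfolding dist_push_push[OF dists_finite_support[OF FaceD(1)[OF p x]]]
  by (rule dist_push_ident[symmetric]) (auto elim: Face_support[OF zsf p x])

text \<open>The decalage raises both dimension and face index by one: an (n+1)-simplex of
  \<open>X\<close> carries lists of length n+2, and d_i acts on them as d_(i+1) of the
  nerve.\<close>

lemma Face_hd_face:
  assumes "p \<in> Face X (nerve G) \<phi>" and "x \<in> simplices X (Suc n)" and "i \<le> Suc n"
  shows "dist_push hd (p n (face X (Suc n) i x)) =
    dist_push (\<lambda>gs. hd (nerve_face G (Suc (Suc n)) (Suc i) gs)) (p (Suc n) x)"
  using dist_push_push[OF dists_finite_support[OF FaceD(1)[OF assms(1,2)]], of hd]
    FaceD(3)[OF assms] by (simp add: nerve_def)

text \<open>The last face only removes the final entry of a list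
  \<open>g # \<phi> (Suc n) x\<close>, whose tail is nonempty, and therefore keeps its head.\<close>

lemma Face_hd_first_vertex:
  fixes p :: "nat \<Rightarrow> 'x \<Rightarrow> 'g list \<Rightarrow> 'r::{comm_semiring_0, comm_monoid_mult}"
  assumes zsf: "zero_sum_free TYPE('r)" and p: "p \<in> Face X (nerve G) \<phi>"
  shows "x \<in> simplices X n \<Longrightarrow> dist_push hd (p n x) = dist_push hd (p 0 (first_vertex n x))"
proof (induction n arbitrary: x)
  case (Suc n)
  have "dist_push hd (p n (face X (Suc n) (Suc n) x)) = dist_push hd (p (Suc n) x)"
    unfolding Face_hd_face[OF p Suc.prems order_refl]
  proof (rule dist_push_cong)
    fix gs assume "p (Suc n) x gs \<noteq> 0"
    then obtain g where "gs = g # \<phi> (Suc n) x" by (rule Face_support[OF zsf p Suc.prems])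
    moreover have "\<phi> (Suc n) x \<noteq> []" using nerve_map_simplex[OF Suc.prems] by auto
    ultimately show "hd (nerve_face G (Suc (Suc n)) (Suc (Suc n)) gs) = hd gs"
      by (simp add: nerve_face_def)
  qed
  then show ?case using Suc by (simp add: face_closed)
qed simp

text \<open>After the index shift, d_0 of \<open>X\<close> becomes d_1 of the nerve, which
  multiplies the head by the label of the edge, while d_1 of \<open>X\<close> becomes d_2, which
  keeps the head.\<close>

lemma Face_hd_edge:
  fixes p :: "nat \<Rightarrow> 'x \<Rightarrow> 'g list \<Rightarrow> 'r::{comm_semiring_0, comm_monoid_mult}"
  assumes zsf: "zero_sum_free TYPE('r)" and p: "p \<in> Face X (nerve G) \<phi>" and \<sigma>: "\<sigma> \<in> simplices X 1"
  shows "dist_push hd (p 0 (face X 1 0 \<sigma>)) =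
    translate (hd (\<phi> 1 \<sigma>)) (dist_push hd (p 0 (face X 1 1 \<sigma>)))"
proof -
  have \<sigma>': "\<sigma> \<in> simplices X (Suc 0)" using \<sigma> by simp
  obtain a where a: "\<phi> 1 \<sigma> = [a]" using nerve_map_edge[OF \<sigma>] by blast
  have "dist_push hd (p 0 (face X 1 0 \<sigma>)) =
      dist_push (\<lambda>gs. hd (nerve_face G 2 1 gs)) (p 1 \<sigma>)"
    using Face_hd_face[OF p \<sigma>', of 0] by (simp add: numeral_2_eq_2)
  also have "\<dots> = dist_push (\<lambda>gs. hd gs \<otimes> a) (p 1 \<sigma>)"
    by (rule dist_push_cong)
      (auto elim!: Face_support[OF zsf p \<sigma>] simp: a nerve_face_def simp del: One_nat_def)
  also have "\<dots> = translate a (dist_push hd (p 1 \<sigma>))"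
    by (rule dist_push_push[OF dists_finite_support[OF FaceD(1)[OF p \<sigma>]], symmetric])
  also have "dist_push hd (p 1 \<sigma>) = dist_push hd (p 0 (face X 1 1 \<sigma>))"
    using Face_hd_first_vertex[OF zsf p \<sigma>] by simp
  finally show ?thesis using a by simp
qed

lemma Face_hd_walk:
  fixes p :: "nat \<Rightarrow> 'x \<Rightarrow> 'g list \<Rightarrow> 'r::{comm_semiring_0, comm_monoid_mult}"
  assumes zsf: "zero_sum_free TYPE('r)" and p: "p \<in> Face X (nerve G) \<phi>"
  shows "u \<in> simplices X 0 \<Longrightarrow> walk u es v \<Longrightarrow>
    dist_push hd (p 0 v) = translate (walk_value es) (dist_push hd (p 0 u))"
proof (induction u es v rule: walk.induct)
  case (1 u v)
  then show ?case using translate_one[OF Face_hd_in_dists[OF p]] by simp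
next
  case (2 u \<sigma> i es v)
  let ?q = "\<lambda>v. dist_push hd (p 0 v)" and ?a = "hd (\<phi> 1 \<sigma>)"
  have \<sigma>: "\<sigma> \<in> simplices X 1" and i: "i \<in> {0, 1}" and u: "u = face X 1 i \<sigma>"
    and es: "walk (face X 1 (1 - i) \<sigma>) es v"
    using 2 by auto
  have q: "?q u \<in> dists (carrier G)" "?q (face X 1 1 \<sigma>) \<in> dists (carrier G)"
    using Face_hd_in_dists[OF p] 2 face_edge[OF \<sigma>] by auto
  have a: "?a \<in> carrier G" by (rule nerve_map_edge_carrier[OF \<sigma>])
  have step: "?q (face X 1 (1 - i) \<sigma>) = translate (step_value (\<sigma>, i)) (?q u)"
  proof (cases "i = 1")
    case True
    then show ?thesis using Face_hd_edge[OF zsf p \<sigma>] u by (simp add: step_value_def)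
  next
    case False
    then have [simp]: "i = 0" using i by simp
    \<comment> \<open>The edge law leads from the face of index 1 to the face of index 0; traversing
      the edge backwards inverts the translation.\<close>
    have "translate (inv ?a) (?q (face X 1 0 \<sigma>)) = ?q (face X 1 1 \<sigma>)"
      unfolding Face_hd_edge[OF zsf p \<sigma>]
      using a q by (simp add: translate_translate translate_one del: One_nat_def)
    then show ?thesis using u by (simp add: step_value_def)
  qed
  have "?q v = translate (walk_value es) (?q (face X 1 (1 - i) \<sigma>))"
    using 2 face_edge[OF \<sigma>, of "1 - i"] by simp
  also have "\<dots> = translate (walk_value ((\<sigma>, i) # es)) (?q u)"
    unfolding step using translate_translate[OF q(1) walk_value_carrier[OF es] step_value_carrier[OF \<sigma>]]
    by simp
  finally show ?case .
qed

text \<open>Transport around a circle fixes the distribution at a vertex \<open>u\<close> of the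
  circle. A walk from \<open>u\<close> to \<open>v\<close> carries this to \<open>v\<close>, because
  translations of an abelian group commute.\<close>

lemma Face_hd_invariant:
  fixes p :: "nat \<Rightarrow> 'x \<Rightarrow> 'g list \<Rightarrow> 'r::{comm_semiring_0, comm_monoid_mult}"
  assumes zsf: "zero_sum_free TYPE('r)" and p: "p \<in> Face X (nerve G) \<phi>"
    and conn: "sset_connected X" and v: "v \<in> simplices X 0"
  shows "dist_push hd (p 0 v) \<in> invariant_dists G X \<phi>"
proof -
  let ?q = "\<lambda>v. dist_push hd (p 0 v)"
  let ?K = "{h \<in> carrier G. translate h (?q v) = ?q v}"
  have q: "?q u \<in> dists (carrier G)" if "u \<in> simplices X 0" for u
    using Face_hd_in_dists[OF p that] .
  have "{circle_value G \<phi> n \<sigma> \<iota> | n \<sigma> \<iota>. circle X n \<sigma> \<iota>} \<subseteq> ?K"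
  proof clarify
    fix n \<sigma> \<iota> assume circ: "circle X n \<sigma> \<iota>"
    obtain u es where u: "u \<in> simplices X 0" and es: "walk u es u"
      and c: "walk_value es = circle_value G \<phi> n \<sigma> \<iota>"
      by (rule circle_to_walk[OF circ])
    obtain as where as: "walk u as v" using connected_walk[OF conn u v] .
    have carr: "walk_value as \<in> carrier G" "walk_value es \<in> carrier G"
      using as es walk_value_carrier by auto
    have "translate (walk_value es) (?q v) =
        translate (walk_value es) (translate (walk_value as) (?q u))"
      using Face_hd_walk[OF zsf p u as] by simp
    also have "\<dots> = translate (walk_value as) (translate (walk_value es) (?q u))"
      using carr q[OF u] by (simp add: translate_translate m_comm)
    also have "\<dots> = ?q v"
      using Face_hd_walk[OF zsf p u as] Face_hd_walk[OF zsf p u es] by simp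
    finally show "circle_value G \<phi> n \<sigma> \<iota> \<in> carrier G \<and>
        translate (circle_value G \<phi> n \<sigma> \<iota>) (?q v) = ?q v"
      using carr c by simp
  qed
  then have "H \<subseteq> ?K"
    unfolding circle_subgroup_def
    by (rule generate_subgroup_incl[OF _ subgroup_translation_stabilizer[OF q[OF v]]])
  then show ?thesis using q[OF v] by (auto simp: invariant_dists_iff)
qed

section \<open>From an invariant distribution back to a face map\<close>

lemma nerve_face_Cons:
  assumes "length l = Suc n" "0 < i" "i \<le> Suc n"
  shows "nerve_face G (Suc (Suc n)) (Suc i) (a # l) = a # nerve_face G (Suc n) i l"
proof -
  obtain k where "i = Suc k" using assms(2) by (cases i) auto
  then show ?thesis using assms by (auto simp: nerve_face_def)
qed

text \<open>With \<open>w\<close> a potential, \<open>q\<close> is transported from the base vertex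
  to the first vertex of \<open>x\<close>. Restriction to \<open>simplices X n\<close> supplies the
  value \<open>undefined\<close> that simplicial maps have elsewhere.\<close>

definition Face_of_dist :: "('x \<Rightarrow> 'g) \<Rightarrow> ('g \<Rightarrow> 'r) \<Rightarrow>
    nat \<Rightarrow> 'x \<Rightarrow> 'g list \<Rightarrow> 'r::{comm_semiring_0, comm_monoid_mult}" where
  "Face_of_dist w q =
     (\<lambda>n. \<lambda>x \<in> simplices X n. dist_push (\<lambda>g. (g \<otimes> w (first_vertex n x)) # \<phi> n x) q)"

text \<open>Degeneracies and faces of positive index keep the first vertex and leave the head alone,
  so they only involve \<open>\<phi>\<close>. The zeroth face moves the first vertex along the first
  edge; the resulting discrepancy in the potential lies in \<open>H\<close> and is absorbed by the
  invariance of \<open>q\<close>.\<close>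

lemma Face_of_dist_in_Face:
  assumes conn: "sset_connected X" and v: "v \<in> simplices X 0"
    and w: "\<And>u. u \<in> simplices X 0 \<Longrightarrow> \<exists>es. walk v es u \<and> w u = walk_value es"
    and q: "q \<in> invariant_dists G X \<phi>"
  shows "Face_of_dist w q \<in> Face X (nerve G) \<phi>"
proof (rule FaceI)
  have D: "q \<in> dists (carrier G)" and inv: "\<And>h. h \<in> H \<Longrightarrow> translate h q = q"
    using q by (auto simp: invariant_dists_iff)
  note fin = dists_finite_support[OF D] and supp = dists_support[OF D]
  have wc: "w u \<in> carrier G" if "u \<in> simplices X 0" for u
    using w[OF that] walk_value_carrier by auto
  have eq: "Face_of_dist w q n x = dist_push (\<lambda>g. (g \<otimes> w (first_vertex n x)) # \<phi> n x) q"
    if "x \<in> simplices X n" for n x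
    using that by (simp add: Face_of_dist_def)
  show "Face_of_dist w q n x \<in> dists (simplices (nerve G) (Suc n))" if x: "x \<in> simplices X n" for n x
    unfolding eq[OF x] using nerve_map_simplex[OF x] wc[OF first_vertex_closed[OF x]]
    by (intro dist_push_in_dists[OF D]) (simp add: nerve_def)
  show "Face_of_dist w q n x = undefined" if "x \<notin> simplices X n" for n x
    using that by (simp add: Face_of_dist_def)
  show "dist_push (face (nerve G) (Suc n) 0) (Face_of_dist w q n x) = dist_unit (\<phi> n x)"
    if x: "x \<in> simplices X n" for n x
    unfolding eq[OF x] dist_push_push[OF fin]
    by (rule dist_push_const[OF D]) (simp add: nerve_def nerve_face_def)
  show "Face_of_dist w q (Suc n) (degen X n j x) =
      dist_push (degen (nerve G) (Suc n) (Suc j)) (Face_of_dist w q n x)"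
    if x: "x \<in> simplices X n" and j: "j \<le> n" for n x j
    unfolding eq[OF x] eq[OF degen_closed[OF x j]] dist_push_push[OF fin]
      first_vertex_degen[OF x j] nerve_map_degen[OF x j]
    by (simp add: nerve_def)
  show "Face_of_dist w q n (face X (Suc n) i x) =
      dist_push (face (nerve G) (Suc (Suc n)) (Suc i)) (Face_of_dist w q (Suc n) x)"
    if x: "x \<in> simplices X (Suc n)" and i: "i \<le> Suc n" for n x i
  proof -
    let ?y = "face X (Suc n) i x" and ?v = "first_vertex (Suc n) x"
    have len: "length (\<phi> (Suc n) x) = Suc n" using nerve_map_simplex[OF x] by simp
    note vc = wc[OF first_vertex_closed[OF x]] wc[OF first_vertex_closed[OF face_closed[OF x i]]]
    have "dist_push (\<lambda>g. (g \<otimes> w (first_vertex n ?y)) # \<phi> n ?y) q =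
        dist_push (\<lambda>g. nerve_face G (Suc (Suc n)) (Suc i) ((g \<otimes> w ?v) # \<phi> (Suc n) x)) q"
    proof (cases "i = 0")
      case False
      then show ?thesis
        using nerve_face_Cons[OF len _ i] first_vertex_face[OF x _ i] nerve_map_face[OF x i]
        by (simp del: first_vertex.simps)
    next
      case True
      obtain e where e: "e \<in> simplices X 1" "face X 1 1 e = ?v" "face X 1 0 e = first_vertex n ?y"
        "hd (\<phi> 1 e) = hd (\<phi> (Suc n) x)"
        using first_edge[OF x] True by metis
      obtain h where h: "h \<in> H" "w ?v \<otimes> hd (\<phi> (Suc n) x) = h \<otimes> w (first_vertex n ?y)"
        using potential_edge[OF conn v w e(1)] e by metis
      obtain a l where al: "\<phi> (Suc n) x = a # l" using len by (cases "\<phi> (Suc n) x") auto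
      have a: "a \<in> carrier G" and l: "\<phi> n ?y = l"
        using nerve_map_simplex[OF x] nerve_map_face[OF x i] al True by (auto simp: nerve_face_def)
      \<comment> \<open>Invariance inserts the translation by \<open>h\<close>, which turns the
        potential at the new first vertex into the potential at the old one times the first
        label.\<close>
      have "dist_push (\<lambda>g. (g \<otimes> w (first_vertex n ?y)) # l) q =
          dist_push (\<lambda>g. (g \<otimes> w (first_vertex n ?y)) # l) (translate h q)"
        using inv[OF h(1)] by simp
      also have "\<dots> = dist_push (\<lambda>g. (g \<otimes> h \<otimes> w (first_vertex n ?y)) # l) q"
        by (rule dist_push_push[OF fin])
      also have "\<dots> = dist_push (\<lambda>g. (g \<otimes> w ?v \<otimes> a) # l) q"
        using h vc a H_carrier[OF h(1)] al by (intro dist_push_cong) (simp add: m_assoc supp)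
      also have "\<dots> = dist_push (\<lambda>g. nerve_face G (Suc (Suc n)) (Suc i) ((g \<otimes> w ?v) # \<phi> (Suc n) x)) q"
        using True by (simp add: al nerve_face_def)
      finally show ?thesis using l by simp
    qed
    then show ?thesis
      unfolding eq[OF x] eq[OF face_closed[OF x i]] dist_push_push[OF fin] by (simp add: nerve_def)
  qed
qed

text \<open>Transport along the chosen walks recovers the distribution of heads at each first
  vertex, and the heads determine \<open>p\<close>; this gives injectivity of evaluation at
  \<open>v\<close>.\<close>

lemma Face_of_dist_hd:
  fixes p :: "nat \<Rightarrow> 'x \<Rightarrow> 'g list \<Rightarrow> 'r::{comm_semiring_0, comm_monoid_mult}"
  assumes zsf: "zero_sum_free TYPE('r)" and p: "p \<in> Face X (nerve G) \<phi>" and v: "v \<in> simplices X 0"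
    and w: "\<And>u. u \<in> simplices X 0 \<Longrightarrow> \<exists>es. walk v es u \<and> w u = walk_value es"
  shows "Face_of_dist w (dist_push hd (p 0 v)) = p"
proof (rule ext, rule ext)
  fix n x
  have fin: "finite {g. dist_push hd (p 0 v) g \<noteq> 0}"
    by (rule dists_finite_support[OF Face_hd_in_dists[OF p v]])
  show "Face_of_dist w (dist_push hd (p 0 v)) n x = p n x"
  proof (cases "x \<in> simplices X n")
    case True
    obtain es where es: "walk v es (first_vertex n x)" "w (first_vertex n x) = walk_value es"
      using w[OF first_vertex_closed[OF True]] by blast
    have "p n x = dist_push (\<lambda>g. g # \<phi> n x) (dist_push hd (p 0 (first_vertex n x)))"
      using Face_eq_push_hd[OF zsf p True] Face_hd_first_vertex[OF zsf p True] by simp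
    also have "\<dots> = dist_push (\<lambda>g. g # \<phi> n x)
        (translate (w (first_vertex n x)) (dist_push hd (p 0 v)))"
      using Face_hd_walk[OF zsf p v es(1)] es(2) by simp
    also have "\<dots> = Face_of_dist w (dist_push hd (p 0 v)) n x"
      using True by (simp add: dist_push_push[OF fin] Face_of_dist_def)
    finally show ?thesis by simp
  qed (simp add: Face_of_dist_def FaceD(2)[OF p])
qed

lemma hd_Face_of_dist:
  assumes q: "q \<in> dists (carrier G)" and v: "v \<in> simplices X 0" and w: "w v = \<one>"
  shows "dist_push hd (Face_of_dist w q 0 v) = q"
  using v translate_one[OF q] w
  by (simp add: Face_of_dist_def dist_push_push[OF dists_finite_support[OF q]])

text \<open>Evaluation at \<open>v\<close> followed by \<open>hd\<close> is linear in the face map,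
  hence convex, and \<open>convex_isoI\<close> then asks only for an inverse between sets.\<close>

theorem Face_isomorphic_invariant_dists:
  assumes zsf: "zero_sum_free TYPE('r::{comm_semiring_0, comm_monoid_mult})"
    and conn: "sset_connected X"
  shows "convex_isomorphic
    (Face X (nerve G) \<phi> :: (nat \<Rightarrow> 'x \<Rightarrow> 'g list \<Rightarrow> 'r) set) (maps_join X)
    (invariant_dists G X \<phi>) dist_join"
proof -
  obtain v where v: "v \<in> simplices X 0" using connected_nonempty[OF conn] by blast
  obtain w where w1: "w v = \<one>"
    and w: "\<And>u. u \<in> simplices X 0 \<Longrightarrow> \<exists>es. walk v es u \<and> w u = walk_value es"
    using potential[OF conn v] by metis
  let ?F = "Face X (nerve G) \<phi> :: (nat \<Rightarrow> 'x \<Rightarrow> 'g list \<Rightarrow> 'r) set"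
  let ?f = "\<lambda>p :: nat \<Rightarrow> 'x \<Rightarrow> 'g list \<Rightarrow> 'r. dist_push hd (p 0 v)"
  have "convex_map ?F (maps_join X) (invariant_dists G X \<phi>) dist_join ?f"
    unfolding convex_map_def
  proof (intro conjI ballI)
    show "?f \<in> ?F \<rightarrow> invariant_dists G X \<phi>"
      using Face_hd_invariant[OF zsf _ conn v] by blast
    fix Q :: "(nat \<Rightarrow> 'x \<Rightarrow> 'g list \<Rightarrow> 'r) \<Rightarrow> 'r" assume Q: "Q \<in> dists ?F"
    have "?f (maps_join X Q) t = dist_expect Q (\<lambda>p. ?f p t)" for t
      by (rule dist_push_maps_join[OF Q v]) (rule FaceD(1)[OF _ v])
    then show "?f (maps_join X Q) = dist_join (dist_push ?f Q)"
      by (simp add: fun_eq_iff dist_join_eq_expect dist_expect_push[OF dists_finite_support[OF Q]])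
  qed
  then have "convex_iso ?F (maps_join X) (invariant_dists G X \<phi>) dist_join ?f"
  proof (rule convex_isoI[OF convex_set_Face convex_set_invariant_dists])
    show "Face_of_dist w \<in> invariant_dists G X \<phi> \<rightarrow> ?F"
      using Face_of_dist_in_Face[OF conn v w] by blast
    show "Face_of_dist w (?f p) = p" if "p \<in> ?F" for p
      by (rule Face_of_dist_hd[OF zsf that v w])
    show "?f (Face_of_dist w q) = q" if "q \<in> invariant_dists G X \<phi>" for q
      using that v w1 by (intro hd_Face_of_dist) (simp_all add: invariant_dists_iff)
  qed
  then show ?thesis unfolding convex_isomorphic_def by blast
qed


section \<open>Distributions on the orbit set\<close>

abbreviation orbit where "orbit g \<equiv> g <# H"

lemma orbit_mult: "g \<in> carrier G \<Longrightarrow> h \<in> H \<Longrightarrow> orbit (g \<otimes> h) = orbit g"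
  using l_repr_independence[of "g \<otimes> h" g H] subgroup_H by (auto simp: l_coset_def)

lemma orbit_fibre:
  assumes g: "g \<in> carrier G"
  shows "{s \<in> carrier G. orbit s = orbit g} = (\<lambda>h. g \<otimes> h) ` H"
proof (intro equalityI subsetI)
  fix s assume s: "s \<in> {s \<in> carrier G. orbit s = orbit g}"
  then have "s \<in> orbit s"
    using subgroup.one_closed[OF subgroup_H] by (force simp: l_coset_def)
  then show "s \<in> (\<lambda>h. g \<otimes> h) ` H" using s by (auto simp: l_coset_def)
next
  fix s assume "s \<in> (\<lambda>h. g \<otimes> h) ` H"
  then show "s \<in> {s \<in> carrier G. orbit s = orbit g}"
    using g by (auto simp: orbit_mult H_carrier)
qed

text \<open>Multiplication by \<open>g\<close> parametrizes the fibre injectively by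
  \<open>H\<close>, so a function constant on it contributes one equal term for each element of
  \<open>H\<close>.\<close>

lemma sum_orbit_fibre:
  assumes g: "g \<in> carrier G"
  shows "(\<Sum>s | s \<in> carrier G \<and> orbit s = orbit g. f s) = (\<Sum>h\<in>H. f (g \<otimes> h))"
proof -
  have "inj_on (\<lambda>h. g \<otimes> h) H" using g by (auto intro!: inj_onI simp: H_carrier)
  then show ?thesis unfolding orbit_fibre[OF g] by (simp add: sum.reindex)
qed

text \<open>Here \<open>u\<close> is an inverse of |H| in the semiring. Writing |H| as a sum of ones
  makes sense also when 0 = 1.\<close>

context
  fixes u :: "'r::{comm_semiring_0, comm_monoid_mult}"
  assumes finite_G: "finite (carrier G)" and u: "u * (\<Sum>h\<in>H. 1) = 1"
begin

text \<open>Each coset has |H| elements of weight q times \<open>u\<close>, which restores its mass.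
  The test function 1 then gives the total mass of the lift, and indicators show that pushing the
  lift forward returns \<open>q\<close>.\<close>

lemma dist_expect_lift_dist:
  assumes q: "q \<in> dists (orbit_set G X \<phi>)"
  shows "dist_expect (lift_dist G X \<phi> u q) (\<lambda>g. h (orbit g)) = dist_expect q h"
proof -
  let ?f = "\<lambda>g. q (orbit g) * u * h (orbit g)"
  have "dist_expect (lift_dist G X \<phi> u q) (\<lambda>g. h (orbit g)) = (\<Sum>g\<in>carrier G. ?f g)"
    by (subst dist_expect_superset[OF finite_G])
      (auto simp: lift_dist_def intro!: sum.cong split: if_splits)
  also have "\<dots> = (\<Sum>C\<in>orbit ` carrier G. \<Sum>g | g \<in> carrier G \<and> orbit g = C. ?f g)"
    by (rule sum.image_gen[OF finite_G])
  also have "\<dots> = (\<Sum>C\<in>orbit ` carrier G. q C * h C)"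
  proof (rule sum.cong[OF refl])
    fix C assume "C \<in> orbit ` carrier G"
    then obtain g where g: "g \<in> carrier G" "C = orbit g" by blast
    \<comment> \<open>The factor \<open>u * 1\<close> is displayed so that the equal terms collect
      into \<open>u * (\<Sum>k\<in>H. 1)\<close>, which is 1.\<close>
    have "(\<Sum>g | g \<in> carrier G \<and> orbit g = C. ?f g) = (\<Sum>k\<in>H. q C * h C * (u * 1))"
      unfolding g(2) sum_orbit_fibre[OF g(1)]
      by (intro sum.cong refl) (simp add: orbit_mult[OF g(1)] mult_ac)
    also have "\<dots> = q C * h C * (u * (\<Sum>k\<in>H. 1))" by (simp only: sum_distrib_left)
    finally show "(\<Sum>g | g \<in> carrier G \<and> orbit g = C. ?f g) = q C * h C" by (simp only: u mult_1_right)
  qed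
  also have "\<dots> = dist_expect q h"
    using q finite_G dists_support[OF q]
    by (intro dist_expect_superset[symmetric]) (auto simp: orbit_set_def)
  finally show ?thesis .
qed

lemma lift_dist_in_invariant_dists:
  assumes q: "q \<in> dists (orbit_set G X \<phi>)"
  shows "lift_dist G X \<phi> u q \<in> invariant_dists G X \<phi>"
proof -
  have "{g. lift_dist G X \<phi> u q g \<noteq> 0} \<subseteq> carrier G" by (auto simp: lift_dist_def)
  moreover have "dist_expect (lift_dist G X \<phi> u q) (\<lambda>_. 1) = 1"
    using dist_expect_lift_dist[OF q, of "\<lambda>_. 1"] dists_total[OF q] by simp
  ultimately have "lift_dist G X \<phi> u q \<in> dists (carrier G)"
    using finite_subset[OF _ finite_G] by (simp add: dists_iff)
  then show ?thesis
    by (simp add: invariant_dists_def lift_dist_def H_carrier orbit_mult)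
qed

lemma dist_push_lift_dist:
  assumes q: "q \<in> dists (orbit_set G X \<phi>)"
  shows "dist_push orbit (lift_dist G X \<phi> u q) = q"
proof
  fix C
  have "lift_dist G X \<phi> u q \<in> dists (carrier G)"
    using lift_dist_in_invariant_dists[OF q] by (simp add: invariant_dists_def)
  then have "dist_push orbit (lift_dist G X \<phi> u q) C = dist_expect q (\<lambda>s. dist_unit s C)"
    using dist_expect_lift_dist[OF q, of "\<lambda>s. dist_unit s C"]
    by (simp add: dist_push_eq_expect dists_finite_support)
  also have "\<dots> = dist_push (\<lambda>s. s) q C"
    by (rule dist_push_eq_expect[OF dists_finite_support[OF q], symmetric])
  finally show "dist_push orbit (lift_dist G X \<phi> u q) C = q C"
    by (simp add: dist_push_ident)
qed

text \<open>An invariant \<open>p\<close> is constant on cosets, so the mass of a coset is |H| times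
  its value there, and \<open>u\<close> cancels |H|.\<close>

lemma lift_dist_push:
  assumes p: "p \<in> invariant_dists G X \<phi>"
  shows "lift_dist G X \<phi> u (dist_push orbit p) = p"
proof
  fix g
  have D: "p \<in> dists (carrier G)" using p by (simp add: invariant_dists_def)
  show "lift_dist G X \<phi> u (dist_push orbit p) g = p g"
  proof (cases "g \<in> carrier G")
    case True
    have "dist_push orbit p (orbit g) = (\<Sum>s | s \<in> carrier G \<and> orbit s = orbit g. p s)"
      unfolding dist_push_def using finite_G dists_support[OF D]
      by (intro sum.mono_neutral_left) auto
    also have "\<dots> = (\<Sum>h\<in>H. p g * 1)"
      unfolding sum_orbit_fibre[OF True] using p True by (simp add: invariant_dists_def)
    also have "\<dots> = p g * (\<Sum>h\<in>H. 1)" by (rule sum_distrib_left[symmetric])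
    finally have "dist_push orbit p (orbit g) * u = p g * (u * (\<Sum>h\<in>H. 1))"
      by (simp only: mult_ac)
    then have "dist_push orbit p (orbit g) * u = p g" by (simp only: u mult_1_right)
    then show ?thesis using True by (simp add: lift_dist_def)
  next
    case False
    then show ?thesis using dists_support[OF D] by (auto simp: lift_dist_def)
  qed
qed

text \<open>Lifting is linear in \<open>q\<close>, hence convex; its inverse is the push-forward
  along the quotient map.\<close>

theorem convex_iso_lift_dist:
  "convex_iso (dists (orbit_set G X \<phi>)) dist_join (invariant_dists G X \<phi>) dist_join
    (lift_dist G X \<phi> u)"
proof (rule convex_isoI[where g = "dist_push orbit"])
  show "convex_set (dists (orbit_set G X \<phi>)) (dist_join :: _ \<Rightarrow> 'g set \<Rightarrow> 'r)"
    by (rule convex_set_dists)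
  show "convex_set (invariant_dists G X \<phi>) (dist_join :: _ \<Rightarrow> 'g \<Rightarrow> 'r)"
    by (rule convex_set_invariant_dists)
  show "convex_map (dists (orbit_set G X \<phi>)) dist_join (invariant_dists G X \<phi>) dist_join
      (lift_dist G X \<phi> u)"
    unfolding convex_map_def
  proof (intro conjI ballI)
    show "lift_dist G X \<phi> u \<in> dists (orbit_set G X \<phi>) \<rightarrow> invariant_dists G X \<phi>"
      using lift_dist_in_invariant_dists by blast
    fix Q :: "('g set \<Rightarrow> 'r) \<Rightarrow> 'r" assume Q: "Q \<in> dists (dists (orbit_set G X \<phi>))"
    have lift: "lift_dist G X \<phi> u q g = (if g \<in> carrier G then q (orbit g) * u else 0)" for q g
      by (simp add: lift_dist_def)
    have zero: "dist_expect Q (\<lambda>_. 0) = 0" by (simp add: dist_expect_def)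
    show "lift_dist G X \<phi> u (dist_join Q) = dist_join (dist_push (lift_dist G X \<phi> u) Q)"
      by (rule ext) (simp add: lift dist_join_eq_expect dist_expect_mult_right zero
          dist_expect_push[OF dists_finite_support[OF Q]])
  qed
  show "dist_push orbit \<in> invariant_dists G X \<phi> \<rightarrow> (dists (orbit_set G X \<phi>) :: (_ \<Rightarrow> 'r) set)"
  proof (rule Pi_I)
    fix p :: "'g \<Rightarrow> 'r" assume "p \<in> invariant_dists G X \<phi>"
    then show "dist_push orbit p \<in> dists (orbit_set G X \<phi>)"
      by (intro dist_push_in_dists[where S = "carrier G"])
        (auto simp: invariant_dists_def orbit_set_def)
  qed
qed (simp_all add: dist_push_lift_dist lift_dist_push)

end

end

theorem proposition3p20:
  fixes G :: "('g, 'm) monoid_scheme"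
    and X :: "'x sset"
    and \<phi> :: "nat \<Rightarrow> 'x \<Rightarrow> 'g list"
  assumes "zero_sum_free TYPE('r::{comm_semiring_0, comm_monoid_mult})"
    and "comm_group G" and "finite (carrier G)"
    and "simplicial_set X" and "sset_connected X" and "one_skeletal X"
    and "finite (simplices X 0)" and "finite (simplices X 1)"
    and "\<phi> \<in> sset_maps X (nerve G)"
  shows "convex_isomorphic
           (Face X (nerve G) \<phi> :: (nat \<Rightarrow> 'x \<Rightarrow> 'g list \<Rightarrow> 'r) set) (maps_join X)
           (invariant_dists G X \<phi>) dist_join
       \<and> (\<forall>u :: 'r. u * (\<Sum>h \<in> circle_subgroup G X \<phi>. 1) = 1 \<longrightarrow>
            convex_iso
              (dists (orbit_set G X \<phi>)) dist_join
              (invariant_dists G X \<phi>) dist_join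
              (lift_dist G X \<phi> u)
          \<and> convex_isomorphic
              (Face X (nerve G) \<phi> :: (nat \<Rightarrow> 'x \<Rightarrow> 'g list \<Rightarrow> 'r) set) (maps_join X)
              (dists (orbit_set G X \<phi>)) dist_join)"
proof -
  interpret nerve_map G X \<phi>
    by (intro nerve_map.intro nerve_map_axioms.intro assms(2,4,9))
  note Face = Face_isomorphic_invariant_dists[OF assms(1,5)]
  show ?thesis
  proof (intro conjI allI impI)
    fix u :: 'r assume u: "u * (\<Sum>h \<in> circle_subgroup G X \<phi>. 1) = 1"
    show iso: "convex_iso (dists (orbit_set G X \<phi>)) dist_join
        (invariant_dists G X \<phi>) dist_join (lift_dist G X \<phi> u)"
      by (rule convex_iso_lift_dist[OF assms(3) u])
    then have "convex_isomorphic (dists (orbit_set G X \<phi>)) dist_join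
        (invariant_dists G X \<phi>) (dist_join :: _ \<Rightarrow> 'g \<Rightarrow> 'r)"
      unfolding convex_isomorphic_def by blast
    from convex_isomorphic_trans[OF Face convex_isomorphic_sym[OF this]]
    show "convex_isomorphic
        (Face X (nerve G) \<phi> :: (nat \<Rightarrow> 'x \<Rightarrow> 'g list \<Rightarrow> 'r) set) (maps_join X)
        (dists (orbit_set G X \<phi>)) dist_join" .
  qed (rule Face)
qed

end
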